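(* Consider the linear regression model $Y = X\beta^* + \varepsilon$ with non-random $n\times p$ design matrix $X=(x_{ij})$, true parameter vector $\beta^*\in\mathbb{R}^p$, and i.i.d. $N(0,\sigma^2)$ errors. Let $\hat\beta^{\mathrm{CV}}$ be the cross-validated Lasso estimate (with user-chosen $\delta>0$, $N_1$, $N_2$) defined in the context, and define $$\hat\sigma^2:=\frac{\|Y-X\hat\beta^{\mathrm{CV}}\|^2}{n}.$$ Let $L := |\beta^*|_1+\delta$, $M := \max_{1\le j\le p}\frac1n\sum_{i=1}^n x_{ij}^4$, $l_1 := \mathbb{E}\log(N_1+1)$, $l_2 := \mathbb{E}\log(N_2+1)$, and $$R:=C_1\frac{\sqrt{l_1}+\sqrt{l_2}}{\sqrt n}+C_2\sqrt{\frac{\log(2p)}{n}}+E_n,$$ where $C_1 = 16(4\sigma^4+2L^2M^{1/2}\sigma^2)^{1/2}$, $C_2 = 96L^2M^{1/2}+57LM^{1/4}\sigma$, and $$E_n = 16\biggl(\frac{(n+5)\sigma^4}{n}+\frac{(n+1)\sigma^2}{n}L^2M^{1/2}\biggr)^{1/2}\biggl(\frac{1+2^{-1/2}}{2}\biggr)^{n/2}.$$ Then $$\mathbb{E}\bigl(|\hat\sigma^2-\sigma^2|;\ N_1\delta\ge|\beta^*|_1,\ N_2\delta\ge|\beta^*|_1\bigr)\le\sigma^2\sqrt{\frac2n}+2\sigma\sqrt R+R.$$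
   Context: Notation: $\|\cdot\|$ is the Euclidean norm, $|\cdot|_1$ is the $\ell^1$ norm on $\mathbb{R}^p$; for a random variable $Z$ and event $A$, $\mathbb{E}(Z;A):=\mathbb{E}(Z1_A)$. Model: $n,p\ge1$; $X$ is an $n\times p$ non-random real matrix with rows $x_1,\dots,x_n$ (so $x_i\beta=\sum_j x_{ij}\beta_j$); $Y=X\beta^*+\varepsilon$, i.e. $y_i=x_i\beta^*+\varepsilon_i$, with $\varepsilon_1,\dots,\varepsilon_n$ i.i.d. $N(0,\sigma^2)$, $\sigma>0$. Cross-validated Lasso estimate: 1. $I\subseteq\{1,\dots,n\}$ is a random subset, independent of $\varepsilon$, obtained by independently putting each element into $I$ or $I^c$ with probability $1/2$ each. 2. For each $K\ge0$, $\hat\beta^{(K,1)}$ is a minimizer of $\sum_{i\in I}(y_i-x_i\beta)^2$ over $|\beta|_1\le K$, and $\hat\beta^{(K,2)}$ is a minimizer of $\sum_{i\in I^c}(y_i-x_i\beta)^2$ over $|\beta|_1\le K$. Ties are broken by some deterministic (measurable) rule. If $I$ (resp. $I^c$) is empty, $\hat\beta^{(K,1)}$ (resp. $\hat\beta^{(K,2)}$) is $0$ for all $K$. 3. $N_1,N_2$ are nonnegative integer-valued random variables, where $N_1$ is a function of $(y_i,x_i)_{i\in I^c}$ and $N_2$ is a function of $(y_i,x_i)_{i\in I}$. 4. $\delta>0$ is a fixed real number. $\hat K_1$ is a minimizer of $\sum_{i\in I}(y_i-x_i\hat\beta^{(K,2)})^2$ over $K\in\{0,\delta,2\delta,\dots,N_1\delta\}$;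 $\hat K_2$ is a minimizer of $\sum_{i\in I^c}(y_i-x_i\hat\beta^{(K,1)})^2$ over $K\in\{0,\delta,\dots,N_2\delta\}$. 5. Define $\hat\mu'\in\mathbb{R}^n$ by $\hat\mu'_i=x_i\hat\beta^{(\hat K_1,2)}$ if $i\in I$ and $\hat\mu'_i=x_i\hat\beta^{(\hat K_2,1)}$ if $i\in I^c$. For each $K\ge0$ let $\hat\beta^{(K)}$ be a minimizer of $\|Y-X\beta\|$ over $|\beta|_1\le K$. Let $\hat K$ be a minimizer of $\|\hat\mu'-X\hat\beta^{(K)}\|$ over $K\ge0$. 6. $\hat\beta^{\mathrm{CV}}:=\hat\beta^{(\hat K)}$. *)

theory Defs
  imports "HOL-Probability.Probability"
begin

definition l1_norm :: "real^'p \<Rightarrow> real" where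
  "l1_norm \<beta> = (\<Sum>j\<in>UNIV. \<bar>\<beta> $ j\<bar>)"

text \<open>
  The responses observed on a set \<open>A\<close> of indices are an element of the product space
  \<open>PiM A (\<lambda>_. borel)\<close>, so a function on this space uses only the
  \<open>y\<^sub>i\<close> with \<open>i \<in> A\<close>; the design is not random and needs no argument of its own.
\<close>

abbreviation data_space :: "'n set \<Rightarrow> ('n \<Rightarrow> real) measure" where
  "data_space A \<equiv> PiM A (\<lambda>_. borel)"

definition data_on :: "'n set \<Rightarrow> real^'n \<Rightarrow> 'n \<Rightarrow> real" where
  "data_on A y = restrict (\<lambda>i. y $ i) A"

text \<open>
  A rule for the constrained Lasso on the subsample \<open>A\<close>: it selects a minimizer deterministically
  and measurably from the bound \<open>K\<close> and the data on \<open>A\<close>. With no data it returns \<open>0\<close>.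
  Values for \<open>K < 0\<close> are irrelevant.
\<close>

definition fold_lasso_rule ::
  "real^'p^'n \<Rightarrow> 'n set \<Rightarrow> (real \<Rightarrow> ('n \<Rightarrow> real) \<Rightarrow> real^'p) \<Rightarrow> bool" where
  "fold_lasso_rule X A b \<longleftrightarrow>
     (\<lambda>(K, y). b K y) \<in> borel_measurable (restrict_space borel {0..} \<Otimes>\<^sub>M data_space A) \<and>
     (\<forall>K\<ge>0. \<forall>y\<in>space (data_space A).
        is_arg_min (\<lambda>\<beta>. \<Sum>i\<in>A. (y i - (X *v \<beta>) $ i)\<^sup>2) (\<lambda>\<beta>. l1_norm \<beta> \<le> K) (b K y) \<and>
        (A = {} \<longrightarrow> b K y = 0))"

definition full_lasso_rule ::
  "real^'p^'n \<Rightarrow> (real \<Rightarrow> real^'n \<Rightarrow> real^'p) \<Rightarrow> bool" where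
  "full_lasso_rule X b \<longleftrightarrow>
     (\<lambda>(K, y). b K y) \<in> borel_measurable (restrict_space borel {0..} \<Otimes>\<^sub>M borel) \<and>
     (\<forall>K\<ge>0. \<forall>y.
        is_arg_min (\<lambda>\<beta>. norm (y - X *v \<beta>)) (\<lambda>\<beta>. l1_norm \<beta> \<le> K) (b K y))"

text \<open>
  The expectations \<open>E log (N + 1)\<close> may be infinite, so the error bound is computed in
  \<open>[0, \<infinity>]\<close> and needs a square root there.
\<close>

definition ennreal_sqrt :: "ennreal \<Rightarrow> ennreal" where
  "ennreal_sqrt x = (if x = \<top> then \<top> else ennreal (sqrt (enn2real x)))"

end

theory Submission
  imports Defs
begin

text \<open>
  On a fold \<open>A\<close>, compare the selected fit with the one at the first grid point
  \<open>k * \<delta>\<close> above \<open>l1_norm \<beta>star\<close>. Minimality bounds the error of the selected fit by the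
  error at \<open>k\<close>, plus twice the pairing of the noise on \<open>A\<close> with the selected fit, minus twice its
  pairing with the fit at \<open>k\<close>. The last pairing has mean zero, because the noise on \<open>A\<close> is independent
  of the training data. The first one is at most \<open>2 * norm Y\<close> (on \<open>A\<close>) times the largest positive
  part of the noise in the directions of the fits, whose second moment is at most
  \<open>3 * \<sigma>\<^sup>2 * ln (N + 1)\<close>. The error at \<open>k\<close> is transferred from \<open>A\<close> to the training half, at the
  cost of a Rademacher quadratic form, and there projection onto a convex set bounds it by a
  linear form in the noise. A triangle inequality passes from the two folds to the refitted
  estimator; its risk controls the variance estimate through
  \<open>\<bar>(norm (\<epsilon> - d))\<^sup>2 - (norm \<epsilon>)\<^sup>2\<bar> \<le> 2 * norm \<epsilon> * norm d + (norm d)\<^sup>2\<close>.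
  The exponentially small term \<open>E\<close> is slack in this argument.
\<close>

section \<open>Deterministic bounds for the constrained Lasso\<close>

text \<open>The obstacle is the event of the theorem. It constrains \<open>N1\<close> and
  \<open>N2\<close> together, and on the fold tested on \<open>I\<close> the range \<open>N2\<close>
  is a function of the very responses that carry the noise, so restricting to the event before
  integrating would destroy the centering of the mean-zero pairing. The risk bound is therefore a
  sum \<open>W + Z\<close> that is nonnegative on the whole space, with \<open>W\<close> nonnegative
  and \<open>Z\<close> of mean zero but without a sign. \<open>Z\<close> is dropped by integration,
  and the event serves only to make \<open>W + Z\<close> a bound for the risk. The random half takes
  finitely many values and is independent of the noise, so noise estimates are proved for a fixed
  set \<open>A\<close> and then averaged over the split. For a fixed \<open>A\<close>, the candidate
  fits and the length of the grid are determined by the responses on \<open>- A\<close>, which are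
  independent of those on \<open>A\<close>. The comparison fit is not chosen by the test data: its
  index depends on \<open>\<beta>star\<close> and \<open>\<delta>\<close> alone. So only the
  selected fit calls for a maximal inequality.\<close>

lemma l1_norm_nonneg: "0 \<le> l1_norm u"
  by (simp add: l1_norm_def sum_nonneg)

lemma l1_norm_le_0D:
  assumes "l1_norm u \<le> 0" shows "u = 0"
proof -
  have "l1_norm u = 0" using assms l1_norm_nonneg[of u] by linarith
  then have "\<forall>j. u $ j = 0"
    unfolding l1_norm_def by (subst (asm) sum_nonneg_eq_0_iff) auto
  then show ?thesis by (simp add: vec_eq_iff)
qed

lemma l1_norm_triangle_diff: "l1_norm (u - v) \<le> l1_norm u + l1_norm v"
  unfolding l1_norm_def sum.distrib[symmetric] by (intro sum_mono) auto

lemma l1_norm_convex: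
  assumes "0 \<le> t" "t \<le> 1" "l1_norm u \<le> K" "l1_norm v \<le> K"
  shows "l1_norm (u + t *\<^sub>R (v - u)) \<le> K"
proof -
  have "\<bar>(u + t *\<^sub>R (v - u)) $ j\<bar> \<le> (1 - t) * \<bar>u $ j\<bar> + t * \<bar>v $ j\<bar>" for j
  proof -
    have "(u + t *\<^sub>R (v - u)) $ j = (1 - t) * u $ j + t * v $ j" by (simp add: algebra_simps)
    then show ?thesis using abs_triangle_ineq[of "(1 - t) * u $ j" "t * v $ j"] assms
      by (simp add: abs_mult)
  qed
  then have "l1_norm (u + t *\<^sub>R (v - u)) \<le> (\<Sum>j\<in>UNIV. (1 - t) * \<bar>u $ j\<bar> + t * \<bar>v $ j\<bar>)"
    unfolding l1_norm_def by (rule sum_mono)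
  also have "\<dots> = (1 - t) * l1_norm u + t * l1_norm v"
    by (simp add: l1_norm_def sum.distrib sum_distrib_left)
  also have "\<dots> \<le> (1 - t) * K + t * K"
    using assms by (intro add_mono mult_left_mono) auto
  finally show ?thesis by (simp add: algebra_simps)
qed

text \<open>First-order optimality on the l1 ball. Moving \<open>b\<close> a little towards the
  feasible \<open>c\<close> cannot decrease the loss, so the residual at \<open>b\<close> has a
  nonnegative pairing \<open>p\<close> with \<open>X *v (b - c)\<close>. The residual is then
  rewritten at \<open>c\<close>, because it is the noise itself when \<open>c\<close> is the true
  parameter.\<close>

lemma lasso_projection:
  fixes X :: "real^'p^'n" and y :: "'n \<Rightarrow> real"
  assumes min: "is_arg_min (\<lambda>\<beta>. \<Sum>i\<in>A. (y i - (X *v \<beta>) $ i)\<^sup>2) (\<lambda>\<beta>. l1_norm \<beta> \<le> K) b"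
    and c: "l1_norm c \<le> K"
  shows "(\<Sum>i\<in>A. ((X *v (b - c)) $ i)\<^sup>2) \<le> (\<Sum>i\<in>A. (y i - (X *v c) $ i) * (X *v (b - c)) $ i)"
proof -
  define d where "d i = (X *v (b - c)) $ i" for i
  define r where "r i = y i - (X *v b) $ i" for i
  define p q where "p = (\<Sum>i\<in>A. r i * d i)" and "q = (\<Sum>i\<in>A. (d i)\<^sup>2)"
  have q0: "q \<ge> 0" by (simp add: q_def sum_nonneg)
  have step: "0 \<le> 2 * p + t * q" if t: "0 < t" "t \<le> 1" for t
  proof -
    have "l1_norm (b + t *\<^sub>R (c - b)) \<le> K"
      using min c t by (intro l1_norm_convex) (auto simp: is_arg_min_def)
    then have "(\<Sum>i\<in>A. (y i - (X *v b) $ i)\<^sup>2) \<le> (\<Sum>i\<in>A. (y i - (X *v (b + t *\<^sub>R (c - b))) $ i)\<^sup>2)"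
      using min by (auto simp: is_arg_min_def not_less)
    moreover have "y i - (X *v (b + t *\<^sub>R (c - b))) $ i = r i + t * d i" for i
      by (simp add: r_def d_def matrix_vector_right_distrib matrix_vector_mult_diff_distrib
          scaleR_matrix_vector_assoc[symmetric] matrix_vector_mult_scaleR algebra_simps)
    ultimately have "(\<Sum>i\<in>A. (r i)\<^sup>2) \<le> (\<Sum>i\<in>A. (r i + t * d i)\<^sup>2)"
      by (simp add: r_def)
    also have "\<dots> = (\<Sum>i\<in>A. (r i)\<^sup>2) + t * (2 * p + t * q)"
      by (simp add: p_def q_def sum.distrib sum_distrib_left power2_eq_square algebra_simps)
    finally have "0 \<le> t * (2 * p + t * q)" by simp
    then show ?thesis using t by (simp add: zero_le_mult_iff)
  qed
  have "0 \<le> p"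
  proof (rule ccontr)
    assume "\<not> 0 \<le> p"
    then have p: "p < 0" by simp
    \<comment> \<open>If \<open>p\<close> were negative, this step length would give
      \<open>t * q \<le> - p\<close> and hence \<open>2 * p + t * q \<le> p < 0\<close>. The added 1
      covers \<open>q = 0\<close>.\<close>
    define t where "t = min 1 (- p / (q + 1))"
    have t: "0 < t" "t \<le> 1" using p q0 by (auto simp: t_def divide_neg_pos)
    have "t * q \<le> - p / (q + 1) * q" using q0 by (intro mult_right_mono) (auto simp: t_def)
    also have "\<dots> \<le> - p" using p q0 by (simp add: field_simps)
    finally show False using step[OF t] p by simp
  qed
  moreover have "(\<Sum>i\<in>A. (y i - (X *v c) $ i) * d i) = p + q"
    by (simp add: p_def q_def r_def d_def matrix_vector_mult_diff_distrib power2_eq_square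
        sum.distrib[symmetric] algebra_simps)
  ultimately show ?thesis by (simp add: q_def d_def)
qed

text \<open>Duality of the l1 norm and the maximum norm. A supremum over all directions
  \<open>u\<close> becomes a maximum of one linear form in the noise per column of \<open>X\<close>,
  which is where the logarithm of \<open>2 * p\<close> originates.\<close>

lemma abs_noise_le:
  fixes X :: "real^'p^'n" and e :: "'n \<Rightarrow> real"
  shows "\<bar>\<Sum>i\<in>A. e i * (X *v u) $ i\<bar> \<le> l1_norm u * Max (range (\<lambda>j. \<bar>\<Sum>i\<in>A. e i * X $ i $ j\<bar>))"
proof -
  have "(\<Sum>i\<in>A. e i * (X *v u) $ i) = (\<Sum>j\<in>UNIV. u $ j * (\<Sum>i\<in>A. e i * X $ i $ j))"
    by (simp add: matrix_vector_mult_def sum_distrib_left mult_ac sum.swap[of _ A])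
  also have "\<bar>\<dots>\<bar> \<le> (\<Sum>j\<in>UNIV. \<bar>u $ j\<bar> * \<bar>\<Sum>i\<in>A. e i * X $ i $ j\<bar>)"
    by (rule order_trans[OF sum_abs]) (simp add: abs_mult)
  also have "\<dots> \<le> (\<Sum>j\<in>UNIV. \<bar>u $ j\<bar> * Max (range (\<lambda>j. \<bar>\<Sum>i\<in>A. e i * X $ i $ j\<bar>)))"
    by (intro sum_mono mult_left_mono Max_ge) auto
  finally show ?thesis by (simp add: l1_norm_def sum_distrib_right)
qed

text \<open>The same duality for the matrix with entries \<open>u $ j * u $ k\<close>, whose
  entrywise l1 norm is the square of \<open>l1_norm u\<close>. The weights \<open>s\<close> are the
  signs of the split in one use and constantly 1 in the other.\<close>

lemma quadratic_form_le:
  fixes X :: "real^'p^'n" and s :: "'n \<Rightarrow> real"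
  shows "(\<Sum>i\<in>UNIV. s i * ((X *v u) $ i)\<^sup>2) \<le>
    (l1_norm u)\<^sup>2 * Max (range (\<lambda>(j, k). \<bar>\<Sum>i\<in>UNIV. s i * (X $ i $ j * X $ i $ k)\<bar>))"
    (is "_ \<le> _ * ?M")
proof -
  have "(\<Sum>i\<in>UNIV. s i * ((X *v u) $ i)\<^sup>2)
      = (\<Sum>i\<in>UNIV. \<Sum>j\<in>UNIV. \<Sum>k\<in>UNIV. u $ j * u $ k * (s i * (X $ i $ j * X $ i $ k)))"
    by (simp add: matrix_vector_mult_def power2_eq_square sum_product sum_distrib_left mult_ac)
  also have "\<dots> = (\<Sum>j\<in>UNIV. \<Sum>i\<in>UNIV. \<Sum>k\<in>UNIV. u $ j * u $ k * (s i * (X $ i $ j * X $ i $ k)))"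
    by (rule sum.swap)
  also have "\<dots> = (\<Sum>j\<in>UNIV. \<Sum>k\<in>UNIV. \<Sum>i\<in>UNIV. u $ j * u $ k * (s i * (X $ i $ j * X $ i $ k)))"
    by (intro sum.cong refl) (rule sum.swap)
  also have "\<dots> = (\<Sum>j\<in>UNIV. \<Sum>k\<in>UNIV. u $ j * u $ k * (\<Sum>i\<in>UNIV. s i * (X $ i $ j * X $ i $ k)))"
    by (simp add: sum_distrib_left)
  also have "\<dots> \<le> (\<Sum>j\<in>UNIV. \<Sum>k\<in>UNIV. \<bar>u $ j\<bar> * \<bar>u $ k\<bar> * ?M)"
  proof (intro sum_mono)
    fix j k
    let ?c = "\<Sum>i\<in>UNIV. s i * (X $ i $ j * X $ i $ k)"
    have "u $ j * u $ k * ?c \<le> \<bar>u $ j * u $ k * ?c\<bar>" by (rule abs_ge_self)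
    also have "\<dots> = \<bar>u $ j\<bar> * \<bar>u $ k\<bar> * \<bar>?c\<bar>" by (simp add: abs_mult)
    also have "\<dots> \<le> \<bar>u $ j\<bar> * \<bar>u $ k\<bar> * ?M"
      by (intro mult_left_mono Max_ge) (auto intro!: image_eqI[of _ _ "(j, k)"])
    finally show "u $ j * u $ k * ?c \<le> \<bar>u $ j\<bar> * \<bar>u $ k\<bar> * ?M" .
  qed
  also have "\<dots> = (l1_norm u)\<^sup>2 * ?M"
    unfolding l1_norm_def power2_eq_square sum_product sum_distrib_right[symmetric] by simp
  finally show ?thesis .
qed

text \<open>This is \<open>0\<close> if \<open>f\<close> vanishes on \<open>A\<close>, since \<open>x / 0 = 0\<close>.\<close>

definition aligned_noise :: "'n set \<Rightarrow> ('n \<Rightarrow> real) \<Rightarrow> ('n \<Rightarrow> real) \<Rightarrow> real" where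
  "aligned_noise A e f = max 0 ((\<Sum>i\<in>A. e i * f i) / L2_set f A)"

lemma sum_mult_le_aligned_noise:
  fixes A :: "'n::finite set"
  shows "(\<Sum>i\<in>A. e i * f i) \<le> L2_set f A * aligned_noise A e f"
proof (cases "L2_set f A = 0")
  case True
  then have "\<forall>i\<in>A. f i = 0" by (subst (asm) L2_set_eq_0_iff) auto
  then show ?thesis using True by simp
next
  case False
  then have "L2_set f A > 0" using L2_set_nonneg[of f A] by linarith
  then show ?thesis
    by (simp add: aligned_noise_def max_def field_simps split: if_splits)
qed

text \<open>
  Only the fit at the selected index is paired with the noise; the fit at the comparison index
  \<open>k\<close> enters linearly, so that its contribution has mean zero.
\<close>

lemma fold_selection_error:
  fixes A :: "'n::finite set" and f :: "nat \<Rightarrow> 'n \<Rightarrow> real"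
  assumes f0: "\<And>i. i \<in> A \<Longrightarrow> f 0 i = 0" and k: "k \<le> N" and h: "h \<le> N"
    and min: "\<And>k. k \<le> N \<Longrightarrow> (\<Sum>i\<in>A. (m i + e i - f h i)\<^sup>2) \<le> (\<Sum>i\<in>A. (m i + e i - f k i)\<^sup>2)"
  shows "(\<Sum>i\<in>A. (m i - f h i)\<^sup>2) \<le> (\<Sum>i\<in>A. (m i - f k i)\<^sup>2)
    + 4 * (L2_set (\<lambda>i. m i + e i) A * Max ((\<lambda>k. aligned_noise A e (f k)) ` {..N}))
    - 2 * (\<Sum>i\<in>A. e i * f k i)"
proof -
  let ?y = "\<lambda>i. m i + e i" and ?T = "Max ((\<lambda>k. aligned_noise A e (f k)) ` {..N})"
  have T: "aligned_noise A e (f h) \<le> ?T" using h by (intro Max_ge) auto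
  have a0: "0 \<le> aligned_noise A e (f h)" by (simp add: aligned_noise_def)
  \<comment> \<open>The zero fit at index 0 is a competitor for every \<open>N\<close>, so the
    selected fit is at most twice as long as the response on \<open>A\<close>.\<close>
  have "(\<Sum>i\<in>A. (?y i - f h i)\<^sup>2) \<le> (\<Sum>i\<in>A. (?y i)\<^sup>2)"
    using min[of 0] f0 by (simp cong: sum.cong)
  then have "(L2_set (f h) A)\<^sup>2 \<le> 2 * (\<Sum>i\<in>A. ?y i * f h i)"
    by (simp add: L2_set_def sum_nonneg power2_diff sum.distrib sum_subtractf sum_distrib_left algebra_simps)
  also have "(\<Sum>i\<in>A. ?y i * f h i) \<le> (\<Sum>i\<in>A. \<bar>?y i\<bar> * \<bar>f h i\<bar>)"
    by (intro sum_mono) (metis abs_ge_self abs_mult)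
  also have "\<dots> \<le> L2_set ?y A * L2_set (f h) A" by (rule L2_set_mult_ineq)
  finally have "L2_set (f h) A * L2_set (f h) A \<le> (2 * L2_set ?y A) * L2_set (f h) A"
    by (simp add: power2_eq_square)
  then have q: "L2_set (f h) A \<le> 2 * L2_set ?y A"
    using L2_set_nonneg[of "f h" A] L2_set_nonneg[of ?y A]
    by (cases "L2_set (f h) A = 0") (auto simp: mult_le_cancel_right)
  have "(\<Sum>i\<in>A. e i * f h i) \<le> L2_set (f h) A * aligned_noise A e (f h)"
    by (rule sum_mult_le_aligned_noise)
  also have "\<dots> \<le> (2 * L2_set ?y A) * ?T"
    using q T a0 L2_set_nonneg[of ?y A] by (intro mult_mono) auto
  finally have 1: "(\<Sum>i\<in>A. e i * f h i) \<le> 2 * (L2_set ?y A * ?T)" by simp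
  \<comment> \<open>The terms without \<open>f k\<close> are the same for every index and cancel
    when the indices \<open>h\<close> and \<open>k\<close> are compared.\<close>
  have expand: "(\<Sum>i\<in>A. (?y i - f k i)\<^sup>2)
      = (\<Sum>i\<in>A. (m i - f k i)\<^sup>2) + 2 * (\<Sum>i\<in>A. e i * m i) - 2 * (\<Sum>i\<in>A. e i * f k i) + (\<Sum>i\<in>A. (e i)\<^sup>2)" for k
    by (simp add: power2_eq_square sum.distrib sum_subtractf sum_distrib_left algebra_simps)
  show ?thesis using min[OF k] 1 unfolding expand by linarith
qed

lemma norm_sq_vec: "(norm (v :: real^'n))\<^sup>2 = (\<Sum>i\<in>UNIV. (v $ i)\<^sup>2)"
  by (simp add: norm_vec_def L2_set_def sum_nonneg)

lemma arg_min_norm_imp_sq: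
  assumes "is_arg_min (\<lambda>\<beta>. norm (y - X *v \<beta>)) P (b :: real^'p)"
  shows "is_arg_min (\<lambda>\<beta>. \<Sum>i\<in>UNIV. ((y :: real^'n) $ i - (X *v \<beta>) $ i)\<^sup>2) P b"
proof -
  have *: "(\<Sum>i\<in>UNIV. (y $ i - (X *v \<beta>) $ i)\<^sup>2) = (norm (y - X *v \<beta>))\<^sup>2" for \<beta> :: "real^'p"
    by (simp add: norm_sq_vec)
  show ?thesis using assms unfolding is_arg_min_def *
    by (metis norm_ge_zero not_less power2_less_imp_less power_mono)
qed

text \<open>The triangle inequality, used twice, gives \<open>2 * a + c\<close> for the distances
  \<open>a\<close> of \<open>m'\<close> and \<open>c\<close> of \<open>g\<close> from
  \<open>m\<close>. Its square is split by Young's inequality with parameter 1/7, so that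
  \<open>32 / 7 = 4 * (1 + 1 / 7)\<close> and \<open>8 = 1 + 7\<close>. The parameter is kept small
  because the first summand carries the selection error, whose constant is the tight one: it has to
  stay below \<open>2 / sqrt 3 - 1\<close>, about 0.154.\<close>

lemma refit_error:
  fixes f g m m' :: "'v::real_normed_vector"
  assumes "norm (m' - f) \<le> norm (m' - g)"
  shows "(norm (f - m))\<^sup>2 \<le> 32 / 7 * (norm (m' - m))\<^sup>2 + 8 * (norm (g - m))\<^sup>2"
proof -
  let ?a = "norm (m' - m)" and ?c = "norm (g - m)"
  have "norm (f - m) \<le> norm (m' - f) + ?a"
    using norm_triangle_ineq4[of "m' - m" "m' - f"] by simp
  moreover have "norm (m' - g) \<le> ?a + ?c"
    using norm_triangle_ineq4[of "m' - m" "g - m"] by simp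
  ultimately have "norm (f - m) \<le> 2 * ?a + ?c" using assms by linarith
  then have "(norm (f - m))\<^sup>2 \<le> (2 * ?a + ?c)\<^sup>2" by (intro power_mono) auto
  also have "\<dots> = 32 / 7 * ?a\<^sup>2 + 8 * ?c\<^sup>2 - 7 * (2 / 7 * ?a - ?c)\<^sup>2"
    by (simp add: power2_eq_square field_simps)
  finally show ?thesis using zero_le_power2[of "2 / 7 * ?a - ?c"] by linarith
qed

text \<open>The first bound is Cauchy-Schwarz against the constant 1 and will be the variance proxy
  of the noise paired with a column. The second is the arithmetic-geometric mean inequality in each
  row and will be the variance proxy of the random signs paired with a product of two
  columns.\<close>

lemma sum_sq_le_moment:
  fixes X :: "real^'p^'n"
  assumes "\<And>j. (1 / real CARD('n)) * (\<Sum>i\<in>UNIV. (X $ i $ j) ^ 4) \<le> M"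
  shows "(\<Sum>i\<in>A. (X $ i $ j)\<^sup>2) \<le> real CARD('n) * sqrt M"
    and "(\<Sum>i\<in>UNIV. (X $ i $ j * X $ i $ k)\<^sup>2) \<le> real CARD('n) * M"
proof -
  have 4: "(\<Sum>i\<in>UNIV. (X $ i $ j) ^ 4) \<le> real CARD('n) * M" for j
    using assms[of j] by (simp add: field_simps)
  have "(\<Sum>i\<in>A. (X $ i $ j)\<^sup>2) \<le> (\<Sum>i\<in>UNIV. \<bar>1\<bar> * \<bar>(X $ i $ j)\<^sup>2\<bar>)"
    by (simp add: sum_mono2)
  also have "\<dots> \<le> L2_set (\<lambda>_. 1) (UNIV :: 'n set) * L2_set (\<lambda>i. (X $ i $ j)\<^sup>2) UNIV"
    by (rule L2_set_mult_ineq)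
  also have "\<dots> = sqrt (real CARD('n) * (\<Sum>i\<in>UNIV. (X $ i $ j) ^ 4))"
    by (simp add: L2_set_def real_sqrt_mult)
  also have "\<dots> \<le> sqrt (real CARD('n) * (real CARD('n) * M))"
    using 4 by (intro real_sqrt_le_mono mult_left_mono) auto
  finally show "(\<Sum>i\<in>A. (X $ i $ j)\<^sup>2) \<le> real CARD('n) * sqrt M"
    by (simp add: real_sqrt_mult flip: mult.assoc)
  have "(\<Sum>i\<in>UNIV. (X $ i $ j * X $ i $ k)\<^sup>2) \<le> (\<Sum>i\<in>UNIV. ((X $ i $ j) ^ 4 + (X $ i $ k) ^ 4) / 2)"
  proof (rule sum_mono)
    fix i
    show "(X $ i $ j * X $ i $ k)\<^sup>2 \<le> ((X $ i $ j) ^ 4 + (X $ i $ k) ^ 4) / 2"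
      using zero_le_power2[of "(X $ i $ j)\<^sup>2 - (X $ i $ k)\<^sup>2"]
      by (simp add: power2_eq_square power4_eq_xxxx algebra_simps)
  qed
  also have "\<dots> = ((\<Sum>i\<in>UNIV. (X $ i $ j) ^ 4) + (\<Sum>i\<in>UNIV. (X $ i $ k) ^ 4)) / 2"
    by (simp add: sum.distrib sum_divide_distrib add_divide_distrib)
  also have "\<dots> \<le> real CARD('n) * M" using 4[of j] 4[of k] by simp
  finally show "(\<Sum>i\<in>UNIV. (X $ i $ j * X $ i $ k)\<^sup>2) \<le> real CARD('n) * M" .
qed

text \<open>All weights of the quadratic form are 1, and the entries of the Gram matrix are
  controlled by its diagonal. The bound is used for the size of the true mean vector
  \<open>X *v \<beta>star\<close>.\<close>

lemma prediction_norm_le: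
  fixes X :: "real^'p^'n"
  assumes M: "\<And>j. (1 / real CARD('n)) * (\<Sum>i\<in>UNIV. (X $ i $ j) ^ 4) \<le> M"
  shows "(\<Sum>i\<in>UNIV. ((X *v u) $ i)\<^sup>2) \<le> (l1_norm u)\<^sup>2 * (real CARD('n) * sqrt M)"
proof -
  have "\<bar>\<Sum>i\<in>UNIV. X $ i $ j * X $ i $ k\<bar> \<le> real CARD('n) * sqrt M" for j k
  proof -
    have "\<bar>\<Sum>i\<in>UNIV. X $ i $ j * X $ i $ k\<bar> \<le> (\<Sum>i\<in>UNIV. ((X $ i $ j)\<^sup>2 + (X $ i $ k)\<^sup>2) / 2)"
    proof (intro order_trans[OF sum_abs] sum_mono)
      fix i
      show "\<bar>X $ i $ j * X $ i $ k\<bar> \<le> ((X $ i $ j)\<^sup>2 + (X $ i $ k)\<^sup>2) / 2"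
        using sum_squares_bound[of "\<bar>X $ i $ j\<bar>" "\<bar>X $ i $ k\<bar>"] by (simp add: abs_mult)
    qed
    also have "\<dots> = ((\<Sum>i\<in>UNIV. (X $ i $ j)\<^sup>2) + (\<Sum>i\<in>UNIV. (X $ i $ k)\<^sup>2)) / 2"
      by (simp add: sum.distrib sum_divide_distrib add_divide_distrib)
    also have "\<dots> \<le> real CARD('n) * sqrt M"
      using sum_sq_le_moment(1)[OF M, of j UNIV] sum_sq_le_moment(1)[OF M, of k UNIV] by simp
    finally show ?thesis .
  qed
  then have "Max (range (\<lambda>(j, k). \<bar>\<Sum>i\<in>UNIV. 1 * (X $ i $ j * X $ i $ k)\<bar>)) \<le> real CARD('n) * sqrt M"
    by (subst Max_le_iff) auto
  from mult_left_mono[OF this, of "(l1_norm u)\<^sup>2"] quadratic_form_le[of "\<lambda>_. 1" X u]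
  show ?thesis by simp
qed

section \<open>Moments and maximal inequalities\<close>

lemma ennreal_sqrt_ennreal [simp]: "ennreal_sqrt (ennreal x) = ennreal (sqrt x)"
proof (cases "0 \<le> x")
  case True then show ?thesis by (simp add: ennreal_sqrt_def)
next
  case False then show ?thesis by (simp add: ennreal_sqrt_def ennreal_neg)
qed

lemma nn_integral_mult_le_sqrt:
  fixes f g :: "'a \<Rightarrow> real"
  assumes [measurable]: "f \<in> borel_measurable M" "g \<in> borel_measurable M"
    and nn: "\<And>x. 0 \<le> f x" "\<And>x. 0 \<le> g x" and ab: "0 \<le> a" "0 \<le> b"
    and fa: "(\<integral>\<^sup>+x. ennreal ((f x)\<^sup>2) \<partial>M) \<le> ennreal a"
    and gb: "(\<integral>\<^sup>+x. ennreal ((g x)\<^sup>2) \<partial>M) \<le> ennreal b"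
  shows "(\<integral>\<^sup>+x. ennreal (f x * g x) \<partial>M) \<le> ennreal (sqrt (a * b))"
proof -
  define x where "x = (\<integral>\<^sup>+x. ennreal (f x * g x) \<partial>M)"
  have "x\<^sup>2 = (\<integral>\<^sup>+x. ennreal (f x) * ennreal (g x) \<partial>M)\<^sup>2"
    using nn by (simp add: x_def ennreal_mult)
  also have "\<dots> \<le> (\<integral>\<^sup>+x. (ennreal (f x))\<^sup>2 \<partial>M) * (\<integral>\<^sup>+x. (ennreal (g x))\<^sup>2 \<partial>M)"
    by (rule Cauchy_Schwarz_nn_integral) auto
  also have "\<dots> \<le> ennreal a * ennreal b"
    using fa gb nn by (intro mult_mono) (auto simp: ennreal_power)
  also have "\<dots> = ennreal (a * b)"
    using ab by (simp add: ennreal_mult)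
  finally have le: "x * x \<le> ennreal (a * b)" by (simp add: power2_eq_square)
  have "x \<noteq> \<top>"
  proof
    assume "x = \<top>"
    with le show False by (simp add: top_unique)
  qed
  then obtain r where r: "0 \<le> r" "x = ennreal r" by (cases x) auto
  have "r * r \<le> a * b"
    using le r(1) ab unfolding r(2) by (simp add: ennreal_mult[symmetric] ennreal_le_iff)
  then have "r \<le> sqrt (a * b)" by (intro real_le_rsqrt) (simp add: power2_eq_square)
  then show ?thesis unfolding x_def[symmetric] r(2) by (rule ennreal_leI)
qed

context prob_space
begin

text \<open>The constant \<open>k\<close> may be negative, as in the tangent bounds for the
  logarithm, so \<open>k + g\<close> cannot be split inside \<open>ennreal\<close>; the sum is
  integrated as a real function.\<close>

lemma nn_integral_le_shift:
  fixes f g :: "'a \<Rightarrow> real"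
  assumes [measurable]: "g \<in> borel_measurable M"
    and f: "\<And>x. x \<in> space M \<Longrightarrow> 0 \<le> f x" "\<And>x. x \<in> space M \<Longrightarrow> f x \<le> k + g x"
    and g: "\<And>x. 0 \<le> g x" and r: "(\<integral>\<^sup>+x. ennreal (g x) \<partial>M) \<le> ennreal r" "0 \<le> r"
  shows "(\<integral>\<^sup>+x. ennreal (f x) \<partial>M) \<le> ennreal (k + r)"
proof -
  have int: "integrable M g"
    using r g by (intro integrableI_nonneg) (auto intro: le_less_trans)
  have "(\<integral>\<^sup>+x. ennreal (g x) \<partial>M) = ennreal (expectation g)"
    using int g by (intro nn_integral_eq_integral) auto
  then have "expectation g \<le> r" using r by (simp add: ennreal_le_iff)
  have "(\<integral>\<^sup>+x. ennreal (f x) \<partial>M) \<le> (\<integral>\<^sup>+x. ennreal (k + g x) \<partial>M)"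
    using f by (intro nn_integral_mono ennreal_leI) auto
  also have "\<dots> = ennreal (expectation (\<lambda>x. k + g x))"
    using int f by (intro nn_integral_eq_integral AE_I2) (auto intro: order_trans)
  also have "\<dots> \<le> ennreal (k + r)"
    using int \<open>expectation g \<le> r\<close> by (intro ennreal_leI) (simp add: prob_space)
  finally show ?thesis .
qed

text \<open>\<open>Z\<close> has no sign, and the integral is not additive in \<open>ennreal\<close>
  for it. When the integral of \<open>W\<close> is finite, linearity of the real expectation applies
  and \<open>Z\<close> disappears; otherwise nothing is claimed.\<close>

lemma nn_integral_add_centered_le:
  fixes W Z :: "'a \<Rightarrow> real"
  assumes [measurable]: "W \<in> borel_measurable M" and W: "\<And>x. 0 \<le> W x"
    and WZ: "\<And>x. x \<in> space M \<Longrightarrow> 0 \<le> W x + Z x"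
    and Z: "integrable M Z" "expectation Z = 0"
  shows "(\<integral>\<^sup>+x. ennreal (W x + Z x) \<partial>M) \<le> (\<integral>\<^sup>+x. ennreal (W x) \<partial>M)"
proof (cases "(\<integral>\<^sup>+x. ennreal (W x) \<partial>M) = \<infinity>")
  case False
  then have int: "integrable M W"
    using W by (intro integrableI_nonneg) (auto simp: less_top)
  have "(\<integral>\<^sup>+x. ennreal (W x + Z x) \<partial>M) = ennreal (expectation (\<lambda>x. W x + Z x))"
    using int Z WZ by (intro nn_integral_eq_integral) auto
  also have "\<dots> = ennreal (expectation W)" using int Z by simp
  also have "\<dots> = (\<integral>\<^sup>+x. ennreal (W x) \<partial>M)"
    using int W by (intro nn_integral_eq_integral[symmetric]) auto
  finally show ?thesis by simp
qed simp

section \<open>Conditioning on one of two independent variables\<close>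

text \<open>\<open>indep_var\<close> forces both variables to have the same value type.\<close>

definition indep_pair :: "'s measure \<Rightarrow> ('a \<Rightarrow> 's) \<Rightarrow> 't measure \<Rightarrow> ('a \<Rightarrow> 't) \<Rightarrow> bool" where
  "indep_pair S X T Y \<longleftrightarrow> X \<in> measurable M S \<and> Y \<in> measurable M T \<and>
    distr M S X \<Otimes>\<^sub>M distr M T Y = distr M (S \<Otimes>\<^sub>M T) (\<lambda>x. (X x, Y x))"

lemma indep_var_imp_indep_pair: "indep_var S X T Y \<Longrightarrow> indep_pair S X T Y"
  by (simp add: indep_pair_def indep_var_distribution_eq)

lemma indep_pairI:
  assumes X[measurable]: "X \<in> measurable M S" and Y[measurable]: "Y \<in> measurable M T"
    and prod: "\<And>A B. A \<in> sets S \<Longrightarrow> B \<in> sets T \<Longrightarrow>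
      prob ((X -` A \<inter> space M) \<inter> (Y -` B \<inter> space M)) = prob (X -` A \<inter> space M) * prob (Y -` B \<inter> space M)"
  shows "indep_pair S X T Y"
  unfolding indep_pair_def
proof (intro conjI X Y pair_measure_eqI)
  interpret X: prob_space "distr M S X" by (rule prob_space_distr) simp
  interpret Y: prob_space "distr M T Y" by (rule prob_space_distr) simp
  show "sigma_finite_measure (distr M S X)" "sigma_finite_measure (distr M T Y)"
    by unfold_locales
  show "sets (distr M S X \<Otimes>\<^sub>M distr M T Y) = sets (distr M (S \<Otimes>\<^sub>M T) (\<lambda>x. (X x, Y x)))"
    by (simp cong: sets_pair_measure_cong)
  fix A B assume "A \<in> sets (distr M S X)" "B \<in> sets (distr M T Y)"
  then have AB[measurable]: "A \<in> sets S" "B \<in> sets T" by auto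
  have "(\<lambda>x. (X x, Y x)) -` (A \<times> B) \<inter> space M = (X -` A \<inter> space M) \<inter> (Y -` B \<inter> space M)"
    by auto
  with prod[OF AB] AB
  show "emeasure (distr M S X) A * emeasure (distr M T Y) B
      = emeasure (distr M (S \<Otimes>\<^sub>M T) (\<lambda>x. (X x, Y x))) (A \<times> B)"
    by (simp add: emeasure_distr emeasure_eq_measure ennreal_mult)
qed

text \<open>Fubini for the product of the two laws, with both laws pulled back to \<open>M\<close>.
  The inner integral then concerns \<open>Y\<close> alone with \<open>X\<close> frozen, so estimates
  for deterministic parameters apply to it.\<close>

lemma indep_pair_nn_integral_iterated:
  assumes ind: "indep_pair S X T Y" and F[measurable]: "F \<in> borel_measurable (S \<Otimes>\<^sub>M T)"
  shows "(\<integral>\<^sup>+\<omega>. F (X \<omega>, Y \<omega>) \<partial>M) = (\<integral>\<^sup>+\<omega>'. \<integral>\<^sup>+\<omega>. F (X \<omega>', Y \<omega>) \<partial>M \<partial>M)"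
proof -
  note D = ind[unfolded indep_pair_def]
  have [measurable]: "X \<in> measurable M S" "Y \<in> measurable M T" using D by auto
  interpret Y: prob_space "distr M T Y" by (rule prob_space_distr) simp
  have "(\<integral>\<^sup>+\<omega>. F (X \<omega>, Y \<omega>) \<partial>M) = (\<integral>\<^sup>+z. F z \<partial>distr M (S \<Otimes>\<^sub>M T) (\<lambda>x. (X x, Y x)))"
    by (subst nn_integral_distr) auto
  also have "\<dots> = (\<integral>\<^sup>+z. F z \<partial>(distr M S X \<Otimes>\<^sub>M distr M T Y))" using D by simp
  also have "\<dots> = (\<integral>\<^sup>+x. \<integral>\<^sup>+y. F (x, y) \<partial>distr M T Y \<partial>distr M S X)"
    by (subst Y.nn_integral_fst[symmetric]) auto
  also have "\<dots> = (\<integral>\<^sup>+x. \<integral>\<^sup>+\<omega>. F (x, Y \<omega>) \<partial>M \<partial>distr M S X)"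
    by (intro nn_integral_cong nn_integral_distr) auto
  also have "\<dots> = (\<integral>\<^sup>+\<omega>'. \<integral>\<^sup>+\<omega>. F (X \<omega>', Y \<omega>) \<partial>M \<partial>M)"
    by (subst nn_integral_distr) auto
  finally show ?thesis .
qed

text \<open>The signed counterpart. Joint integrability is a hypothesis because vanishing inner
  integrals do not imply it.\<close>

lemma indep_pair_expectation_0:
  fixes F :: "_ \<Rightarrow> real"
  assumes ind: "indep_pair S X T Y" and F[measurable]: "F \<in> borel_measurable (S \<Otimes>\<^sub>M T)"
    and int: "integrable M (\<lambda>\<omega>. F (X \<omega>, Y \<omega>))"
    and c: "\<And>x. x \<in> space S \<Longrightarrow> (\<integral>\<omega>. F (x, Y \<omega>) \<partial>M) = 0"
  shows "(\<integral>\<omega>. F (X \<omega>, Y \<omega>) \<partial>M) = 0"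
proof -
  note D = ind[unfolded indep_pair_def]
  have [measurable]: "X \<in> measurable M S" "Y \<in> measurable M T" using D by auto
  interpret X: prob_space "distr M S X" by (rule prob_space_distr) simp
  interpret Y: prob_space "distr M T Y" by (rule prob_space_distr) simp
  interpret XY: pair_prob_space "distr M S X" "distr M T Y" ..
  have int': "integrable (distr M S X \<Otimes>\<^sub>M distr M T Y) F"
    using int D by (simp add: integrable_distr_eq)
  have "(\<integral>\<omega>. F (X \<omega>, Y \<omega>) \<partial>M) = (\<integral>z. F z \<partial>(distr M S X \<Otimes>\<^sub>M distr M T Y))"
    using D by (simp add: integral_distr)
  also have "\<dots> = (\<integral>x. \<integral>y. F (x, y) \<partial>distr M T Y \<partial>distr M S X)"
    using int' by (simp add: XY.integral_fst')
  also have "\<dots> = (\<integral>x. 0 \<partial>distr M S X)"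
    by (intro Bochner_Integration.integral_cong refl)
      (simp add: integral_distr c)
  finally show ?thesis by simp
qed

section \<open>Maximal inequalities from exponential moments\<close>

text \<open>
  The tangent bound \<open>ln S \<le> ln c + S / c - 1\<close> at a bound \<open>c\<close> for the mean of \<open>S\<close> replaces
  Jensen's inequality for the logarithm.
\<close>

lemma nn_integral_Max_abs_le:
  fixes Z :: "'j \<Rightarrow> 'a \<Rightarrow> real"
  assumes J: "finite J" "J \<noteq> {}" and [measurable]: "\<And>j. j \<in> J \<Longrightarrow> Z j \<in> borel_measurable M"
    and v: "0 \<le> v"
    and mgf: "\<And>j t. j \<in> J \<Longrightarrow> (\<integral>\<^sup>+\<omega>. ennreal (exp (t * Z j \<omega>)) \<partial>M) \<le> ennreal (exp (t\<^sup>2 * v / 2))"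
  shows "(\<integral>\<^sup>+\<omega>. ennreal (Max ((\<lambda>j. \<bar>Z j \<omega>\<bar>) ` J)) \<partial>M) \<le> ennreal (sqrt (2 * v * ln (2 * real (card J))))"
    (is "?E \<le> _")
proof -
  define N where "N = real (card J)"
  have N: "N \<ge> 1" using J by (simp add: N_def Suc_leI card_gt_0_iff)
  have bound: "?E \<le> ennreal (ln (2 * N) / t + t * v / 2)" if t: "t > 0" for t
  proof -
    \<comment> \<open>A bound for the mean of \<open>S\<close>: each of the \<open>N\<close>
      variables enters with both signs, and either sign contributes at most
      \<open>exp (t\<^sup>2 * v / 2)\<close>.\<close>
    define c where "c = 2 * N * exp (t\<^sup>2 * v / 2)"
    have c: "c > 0" using N by (simp add: c_def)
    define S where "S \<omega> = (\<Sum>j\<in>J. exp (t * Z j \<omega>) + exp (- t * Z j \<omega>))" for \<omega>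
    have [measurable]: "S \<in> borel_measurable M" unfolding S_def by measurable
    have S0: "0 \<le> S \<omega>" for \<omega> by (simp add: S_def sum_nonneg add_nonneg_nonneg)
    have "(\<integral>\<^sup>+\<omega>. ennreal (S \<omega>) \<partial>M)
        = (\<Sum>j\<in>J. (\<integral>\<^sup>+\<omega>. ennreal (exp (t * Z j \<omega>)) \<partial>M) + (\<integral>\<^sup>+\<omega>. ennreal (exp (- t * Z j \<omega>)) \<partial>M))"
      unfolding S_def
      by (simp add: sum_ennreal[symmetric] add_nonneg_nonneg nn_integral_sum nn_integral_add cong: sum.cong)
    also have "\<dots> \<le> (\<Sum>j\<in>J. ennreal (exp (t\<^sup>2 * v / 2)) + ennreal (exp (t\<^sup>2 * v / 2)))"
      using mgf[of _ t] mgf[of _ "- t"] by (intro sum_mono add_mono) auto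
    also have "\<dots> = ennreal c"
      by (simp add: c_def N_def ennreal_of_nat_eq_real_of_nat ennreal_mult'[symmetric]
          ennreal_plus[symmetric] del: ennreal_plus)
    finally have ES: "(\<integral>\<^sup>+\<omega>. ennreal (S \<omega>) \<partial>M) \<le> ennreal c" .
    have "(\<integral>\<^sup>+\<omega>. ennreal (S \<omega> / (c * t)) \<partial>M) = ennreal (1 / (c * t)) * (\<integral>\<^sup>+\<omega>. ennreal (S \<omega>) \<partial>M)"
      using c t S0 by (subst nn_integral_cmult[symmetric]) (auto simp: ennreal_mult[symmetric])
    also have "\<dots> \<le> ennreal (1 / (c * t)) * ennreal c" by (intro mult_left_mono ES) simp
    also have "\<dots> = ennreal (1 / t)" using c t by (simp add: ennreal_mult[symmetric])
    finally have ES': "(\<integral>\<^sup>+\<omega>. ennreal (S \<omega> / (c * t)) \<partial>M) \<le> ennreal (1 / t)" .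
    have "?E \<le> ennreal ((ln c - 1) / t + 1 / t)"
    proof (rule nn_integral_le_shift[OF _ _ _ _ ES'])
      fix \<omega>
      show "0 \<le> Max ((\<lambda>j. \<bar>Z j \<omega>\<bar>) ` J)"
        using J by (subst Max_ge_iff) auto
      show "Max ((\<lambda>j. \<bar>Z j \<omega>\<bar>) ` J) \<le> (ln c - 1) / t + S \<omega> / (c * t)"
      proof (rule Max.boundedI, use J in simp, use J in simp)
        fix a assume "a \<in> (\<lambda>j. \<bar>Z j \<omega>\<bar>) ` J"
        then obtain j where j: "j \<in> J" and a: "a = \<bar>Z j \<omega>\<bar>" by auto
        have "exp (t * \<bar>Z j \<omega>\<bar>) \<le> exp (t * Z j \<omega>) + exp (- t * Z j \<omega>)"
          by (cases "Z j \<omega> \<ge> 0") (auto simp: add_increasing add_increasing2)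
        also have "\<dots> \<le> S \<omega>"
          unfolding S_def using j J
          by (intro member_le_sum[of j J "\<lambda>j. exp (t * Z j \<omega>) + exp (- t * Z j \<omega>)"])
            (auto simp: add_nonneg_nonneg)
        finally have S: "exp (t * \<bar>Z j \<omega>\<bar>) \<le> S \<omega>" .
        then have S1: "S \<omega> > 0" by (meson exp_gt_zero less_le_trans)
        have "t * \<bar>Z j \<omega>\<bar> \<le> ln (S \<omega>)" using S S1 by (simp add: ln_ge_iff)
        also have "\<dots> = ln c + ln (S \<omega> / c)" using S1 c by (simp add: ln_div)
        also have "\<dots> \<le> ln c + (S \<omega> / c - 1)" using S1 c by (intro add_left_mono ln_le_minus_one) simp
        finally have "t * \<bar>Z j \<omega>\<bar> \<le> ln c - 1 + S \<omega> / c" by simp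
        then have "\<bar>Z j \<omega>\<bar> \<le> (ln c - 1 + S \<omega> / c) / t" using t by (simp add: field_simps)
        then show "a \<le> (ln c - 1) / t + S \<omega> / (c * t)" by (simp add: a add_divide_distrib)
      qed
    qed (use S0 c t in auto)
    also have "(ln c - 1) / t + 1 / t = ln (2 * N) / t + t * v / 2"
      using t N by (simp add: c_def ln_mult field_simps power2_eq_square)
    finally show ?thesis .
  qed
  have ln: "ln (2 * N) > 0" using N by simp
  show ?thesis
  proof (cases "v = 0")
    case True
    \<comment> \<open>Without variance there is no optimal \<open>t\<close>: the bound tends to 0 as
      \<open>t\<close> grows, and \<open>t = ln (2 * N) / e\<close> brings it down to
      \<open>e\<close>.\<close>
    have "?E \<le> 0"
    proof (rule ennreal_le_epsilon)
      fix e :: real assume "0 < e"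
      then show "?E \<le> 0 + ennreal e"
        using bound[of "ln (2 * N) / e"] ln True by simp
    qed
    then show ?thesis using True by simp
  next
    case False
    then have v: "v > 0" using v by simp
    \<comment> \<open>The minimizer of \<open>ln (2 * N) / t + t * v / 2\<close> over positive
      \<open>t\<close>, where the two summands are equal.\<close>
    define s where "s = sqrt (2 * ln (2 * N) / v)"
    have s: "s > 0" "s\<^sup>2 = 2 * ln (2 * N) / v" using ln v by (auto simp: s_def)
    have "ln (2 * N) = v * s\<^sup>2 / 2" using s v by simp
    then have "ln (2 * N) / s + s * v / 2 = s * v"
      using s by (simp add: power2_eq_square field_simps)
    also have "\<dots> = sqrt (2 * v * ln (2 * N))"
      using s ln v by (intro real_sqrt_unique[symmetric]) (auto simp: power_mult_distrib power2_eq_square[of v])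
    finally show ?thesis using bound[OF s(1)] by (simp add: N_def)
  qed
qed

end

text \<open>At one of the points \<open>x\<close> and \<open>- x\<close> the positive part vanishes,
  at the other the exponents combine to those of a normal density:
  \<open>- 1 / 2 + 4 / 9 = - 1 / 18\<close> means standard deviation \<open>3 * \<sigma>\<close>,
  and the normalizing constants differ by the factor 3. Adding the integrand to its reflection
  therefore gives total mass \<open>1 + 3\<close>, twice the integral.\<close>

lemma nn_integral_exp_positive_part_normal:
  assumes s: "\<sigma> > 0"
  shows "(\<integral>\<^sup>+x. ennreal (normal_density 0 \<sigma> x) * ennreal (exp (4 / (9 * \<sigma>\<^sup>2) * (max 0 x)\<^sup>2)) \<partial>lborel) = 2"
    (is "?A = 2")
proof -
  define f where "f x = ennreal (normal_density 0 \<sigma> x * exp (4 / (9 * \<sigma>\<^sup>2) * (max 0 x)\<^sup>2))" for x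
  have [measurable]: "f \<in> borel_measurable borel" unfolding f_def by measurable
  have A: "?A = (\<integral>\<^sup>+x. f x \<partial>lborel)" by (simp add: f_def ennreal_mult)
  have "(\<integral>\<^sup>+x. f x \<partial>lborel) = (\<integral>\<^sup>+x. f (- x) \<partial>lborel)"
    by (subst lborel_distr_uminus[symmetric]) (subst nn_integral_distr, auto)
  then have "2 * ?A = (\<integral>\<^sup>+x. f x \<partial>lborel) + (\<integral>\<^sup>+x. f (- x) \<partial>lborel)"
    unfolding A mult_2 by simp
  also have "\<dots> = (\<integral>\<^sup>+x. f x + f (- x) \<partial>lborel)" by (rule nn_integral_add[symmetric]) auto
  also have "\<dots> = (\<integral>\<^sup>+x. ennreal (normal_density 0 \<sigma> x) + 3 * ennreal (normal_density 0 (3 * \<sigma>) x) \<partial>lborel)"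
  proof (intro nn_integral_cong)
    fix x :: real
    have e: "exp (- x\<^sup>2 / (2 * \<sigma>\<^sup>2)) * exp (4 / (9 * \<sigma>\<^sup>2) * x\<^sup>2) = exp (- x\<^sup>2 / (2 * (3 * \<sigma>)\<^sup>2))"
      unfolding exp_add[symmetric] using s by (simp add: field_simps power2_eq_square)
    have q: "sqrt (2 * pi * (3 * \<sigma>)\<^sup>2) = 3 * sqrt (2 * pi * \<sigma>\<^sup>2)"
    proof -
      have "2 * pi * (3 * \<sigma>)\<^sup>2 = 3\<^sup>2 * (2 * pi * \<sigma>\<^sup>2)" by (simp add: power_mult_distrib)
      then show ?thesis by (simp only: real_sqrt_mult[of "3\<^sup>2"] real_sqrt_abs abs_numeral)
    qed
    have "normal_density 0 \<sigma> x * exp (4 / (9 * \<sigma>\<^sup>2) * x\<^sup>2)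
        = 1 / sqrt (2 * pi * \<sigma>\<^sup>2) * (exp (- x\<^sup>2 / (2 * \<sigma>\<^sup>2)) * exp (4 / (9 * \<sigma>\<^sup>2) * x\<^sup>2))"
      unfolding normal_density_def by simp
    also have "\<dots> = 3 * normal_density 0 (3 * \<sigma>) x"
      unfolding e normal_density_def q by simp
    finally have "normal_density 0 \<sigma> x * exp (4 / (9 * \<sigma>\<^sup>2) * x\<^sup>2) = 3 * normal_density 0 (3 * \<sigma>) x" .
    moreover have "normal_density 0 \<sigma> (- x) = normal_density 0 \<sigma> x" by (simp add: normal_density_def)
    ultimately have *: "normal_density 0 \<sigma> x * exp (4 / (9 * \<sigma>\<^sup>2) * (max 0 x)\<^sup>2)
        + normal_density 0 \<sigma> (- x) * exp (4 / (9 * \<sigma>\<^sup>2) * (max 0 (- x))\<^sup>2)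
        = normal_density 0 \<sigma> x + 3 * normal_density 0 (3 * \<sigma>) x"
      by (cases "x \<ge> 0") (simp_all add: max_def del: times_divide_eq_left)
    have "f x + f (- x) = ennreal (normal_density 0 \<sigma> x + 3 * normal_density 0 (3 * \<sigma>) x)"
      unfolding f_def *[symmetric] by (rule ennreal_plus[symmetric]) auto
    then show "f x + f (- x) = ennreal (normal_density 0 \<sigma> x) + 3 * ennreal (normal_density 0 (3 * \<sigma>) x)"
      by (simp add: ennreal_mult)
  qed
  also have "\<dots> = 1 + 3 * 1"
    using s by (simp add: nn_integral_add nn_integral_cmult nn_integral_eq_integral)
  finally have "2 * ?A = 2 * 2" by simp
  then show ?thesis by (subst (asm) ennreal_mult_cancel_left) auto
qed

section \<open>Gaussian noise\<close>

lemma nn_integral_exp_normal: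
  assumes s: "\<sigma> > 0"
  shows "(\<integral>\<^sup>+x. ennreal (normal_density 0 \<sigma> x) * ennreal (exp (t * x)) \<partial>lborel) = ennreal (exp (t\<^sup>2 * \<sigma>\<^sup>2 / 2))"
proof -
  have "ennreal (normal_density 0 \<sigma> x) * ennreal (exp (t * x))
      = ennreal (exp (t\<^sup>2 * \<sigma>\<^sup>2 / 2)) * ennreal (normal_density (t * \<sigma>\<^sup>2) \<sigma> x)" for x
  proof -
    have "- x\<^sup>2 / (2 * \<sigma>\<^sup>2) + t * x = t\<^sup>2 * \<sigma>\<^sup>2 / 2 + (- (x - t * \<sigma>\<^sup>2)\<^sup>2 / (2 * \<sigma>\<^sup>2))"
      using s by (simp add: field_simps power2_eq_square)
    then have "exp (- x\<^sup>2 / (2 * \<sigma>\<^sup>2)) * exp (t * x) = exp (t\<^sup>2 * \<sigma>\<^sup>2 / 2) * exp (- (x - t * \<sigma>\<^sup>2)\<^sup>2 / (2 * \<sigma>\<^sup>2))"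
      by (simp only: exp_add[symmetric])
    then have "normal_density 0 \<sigma> x * exp (t * x) = exp (t\<^sup>2 * \<sigma>\<^sup>2 / 2) * normal_density (t * \<sigma>\<^sup>2) \<sigma> x"
      unfolding normal_density_def by simp
    then show ?thesis by (simp add: ennreal_mult[symmetric])
  qed
  then have "(\<integral>\<^sup>+x. ennreal (normal_density 0 \<sigma> x) * ennreal (exp (t * x)) \<partial>lborel)
      = ennreal (exp (t\<^sup>2 * \<sigma>\<^sup>2 / 2)) * (\<integral>\<^sup>+x. ennreal (normal_density (t * \<sigma>\<^sup>2) \<sigma> x) \<partial>lborel)"
    by (simp add: nn_integral_cmult)
  also have "(\<integral>\<^sup>+x. ennreal (normal_density (t * \<sigma>\<^sup>2) \<sigma> x) \<partial>lborel) = 1"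
    using s by (simp add: nn_integral_eq_integral)
  finally show ?thesis by simp
qed

lemma ln_double_le:
  assumes "N \<ge> 1"
  shows "9 / 4 * ln (2 * real N) \<le> 3 * ln (real N + 1)"
proof -
  define x where "x = real N"
  have x: "x \<ge> 1" using assms by (simp add: x_def)
  have "(x + 1) ^ 4 - (2 * x) ^ 3 = (x * (x - 2))\<^sup>2 + 2 * x\<^sup>2 + 4 * x + 1"
    by (simp add: power2_eq_square power3_eq_cube power4_eq_xxxx algebra_simps)
  also have "\<dots> \<ge> 0" using x by (intro add_nonneg_nonneg) auto
  finally have "ln ((2 * x) ^ 3) \<le> ln ((x + 1) ^ 4)" using x by simp
  then have "3 * ln (2 * x) \<le> 4 * ln (x + 1)" using x ln_realpow[of "2 * x" 3] ln_realpow[of "x + 1" 4] by simp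
  then show ?thesis by (simp add: x_def)
qed

lemma aligned_noise_cong:
  "(\<And>i. i \<in> A \<Longrightarrow> e i = e' i) \<Longrightarrow> (\<And>i. i \<in> A \<Longrightarrow> f i = f' i) \<Longrightarrow> aligned_noise A e f = aligned_noise A e' f'"
  by (simp add: aligned_noise_def L2_set_def cong: sum.cong)

lemma aligned_noise_zero: "(\<And>i. i \<in> A \<Longrightarrow> f i = 0) \<Longrightarrow> aligned_noise A e f = 0"
  by (simp add: aligned_noise_def)

lemma borel_measurable_aligned_noise [measurable (raw)]:
  fixes A :: "'n::finite set"
  assumes [measurable]: "\<And>i. i \<in> A \<Longrightarrow> (\<lambda>x. e x i) \<in> borel_measurable M" "\<And>i. i \<in> A \<Longrightarrow> (\<lambda>x. f x i) \<in> borel_measurable M"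
  shows "(\<lambda>x. aligned_noise A (e x) (f x)) \<in> borel_measurable M"
  unfolding aligned_noise_def L2_set_def by measurable

locale gaussian_noise = prob_space P for P :: "'a measure" +
  fixes \<epsilon> :: "'a \<Rightarrow> real^'n" and \<sigma> :: real
  assumes \<sigma>_pos: "0 < \<sigma>"
    and indep_noise: "indep_vars (\<lambda>_. borel) (\<lambda>i \<omega>. \<epsilon> \<omega> $ i) UNIV"
    and distributed_noise: "\<And>i. distributed P lborel (\<lambda>\<omega>. \<epsilon> \<omega> $ i) (normal_density 0 \<sigma>)"
begin

lemma noise_component_measurable [measurable]: "(\<lambda>\<omega>. \<epsilon> \<omega> $ i) \<in> borel_measurable P"
  using distributed_measurable[OF distributed_noise[of i]] by simp

lemma noise_measurable [measurable]: "\<epsilon> \<in> borel_measurable P"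
  by (subst borel_measurable_euclidean_space) (auto simp: Basis_vec_def inner_axis)

text \<open>The addition theorem for independent normals wants positive standard deviations, so
  indices with a zero coefficient are discarded; \<open>pos\<close> says that some index
  survives.\<close>

lemma distributed_combination:
  assumes pos: "L2_set a A > 0"
  shows "distributed P lborel (\<lambda>\<omega>. \<Sum>i\<in>A. a i * \<epsilon> \<omega> $ i) (normal_density 0 (\<sigma> * L2_set a A))"
proof -
  define B where "B = {i \<in> A. a i \<noteq> 0}"
  have sumB: "(\<Sum>i\<in>B. g i) = (\<Sum>i\<in>A. g i)" if "\<And>i. i \<in> A \<Longrightarrow> a i = 0 \<Longrightarrow> g i = 0" for g :: "'n \<Rightarrow> real"
    unfolding B_def using that by (intro sum.mono_neutral_left) auto
  have ne: "B \<noteq> {}"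
  proof
    assume "B = {}"
    then have "L2_set a A = 0" by (subst L2_set_eq_0_iff) (auto simp: B_def)
    then show False using pos by simp
  qed
  have ind: "indep_vars (\<lambda>_. borel) (\<lambda>i \<omega>. a i * \<epsilon> \<omega> $ i) B"
    by (rule indep_vars_compose2[OF indep_vars_subset[OF indep_noise, of B], of "\<lambda>i x. a i * x"]) auto
  have "distributed P lborel (\<lambda>\<omega>. a i * \<epsilon> \<omega> $ i) (normal_density 0 (\<bar>a i\<bar> * \<sigma>))" if "i \<in> B" for i
    using normal_density_affine[OF distributed_noise[of i] \<sigma>_pos, of "a i" 0] that by (simp add: B_def)
  then have "distributed P lborel (\<lambda>\<omega>. \<Sum>i\<in>B. a i * \<epsilon> \<omega> $ i)
      (normal_density (\<Sum>i\<in>B. 0) (sqrt (\<Sum>i\<in>B. (\<bar>a i\<bar> * \<sigma>)\<^sup>2)))"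
    using ne ind \<sigma>_pos by (intro sum_indep_normal) (auto simp: B_def)
  also have "(\<Sum>i\<in>B. (\<bar>a i\<bar> * \<sigma>)\<^sup>2) = \<sigma>\<^sup>2 * (\<Sum>i\<in>A. (a i)\<^sup>2)"
    by (subst sumB) (auto simp: power_mult_distrib sum_distrib_left mult_ac)
  also have "sqrt \<dots> = \<sigma> * L2_set a A"
    using \<sigma>_pos by (simp add: real_sqrt_mult L2_set_def)
  finally show ?thesis by (simp add: sumB)
qed

text \<open>The zero combination has no density and is treated separately; both sides are then
  1.\<close>

lemma noise_mgf:
  "(\<integral>\<^sup>+\<omega>. ennreal (exp (t * (\<Sum>i\<in>A. a i * \<epsilon> \<omega> $ i))) \<partial>P) = ennreal (exp (t\<^sup>2 * (\<sigma>\<^sup>2 * (\<Sum>i\<in>A. (a i)\<^sup>2)) / 2))"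
proof (cases "L2_set a A = 0")
  case True
  then have "\<forall>i\<in>A. a i = 0" by (subst (asm) L2_set_eq_0_iff) auto
  then show ?thesis by (simp add: emeasure_space_1)
next
  case False
  then have pos: "L2_set a A > 0" using L2_set_nonneg[of a A] by linarith
  show ?thesis
    using distributed_nn_integral[OF distributed_combination[OF pos], of "\<lambda>x. ennreal (exp (t * x))"]
      nn_integral_exp_normal[of "\<sigma> * L2_set a A" t] pos \<sigma>_pos
    by (simp add: power_mult_distrib L2_set_def sum_nonneg)
qed

lemma nn_integral_Max_noise_le:
  fixes X :: "real^'p^'n"
  assumes v: "\<And>j. (\<Sum>i\<in>A. (X $ i $ j)\<^sup>2) \<le> v"
  shows "(\<integral>\<^sup>+\<omega>. ennreal (Max (range (\<lambda>j. \<bar>\<Sum>i\<in>A. \<epsilon> \<omega> $ i * X $ i $ j\<bar>))) \<partial>P)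
    \<le> ennreal (sqrt (2 * (\<sigma>\<^sup>2 * v) * ln (2 * real CARD('p))))"
proof (rule nn_integral_Max_abs_le)
  have "0 \<le> v" using v by (rule order_trans[OF sum_nonneg, rotated]) auto
  then show "0 \<le> \<sigma>\<^sup>2 * v" by simp
  fix j t
  have "(\<integral>\<^sup>+\<omega>. ennreal (exp (t * (\<Sum>i\<in>A. \<epsilon> \<omega> $ i * X $ i $ j))) \<partial>P)
      = ennreal (exp (t\<^sup>2 * (\<sigma>\<^sup>2 * (\<Sum>i\<in>A. (X $ i $ j)\<^sup>2)) / 2))"
    using noise_mgf[of t "\<lambda>i. X $ i $ j" A] by (simp add: mult.commute)
  also have "\<dots> \<le> ennreal (exp (t\<^sup>2 * (\<sigma>\<^sup>2 * v) / 2))"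
    using v[of j] by (intro ennreal_leI) (auto intro!: mult_left_mono)
  finally show "(\<integral>\<^sup>+\<omega>. ennreal (exp (t * (\<Sum>i\<in>A. \<epsilon> \<omega> $ i * X $ i $ j))) \<partial>P) \<le> ennreal (exp (t\<^sup>2 * (\<sigma>\<^sup>2 * v) / 2))" .
qed auto

text \<open>Dividing by the length of \<open>f\<close> makes the linear form normal with variance
  \<open>\<sigma>\<^sup>2\<close>, whatever the direction. The bound is thus uniform in
  \<open>f\<close>, as needed when \<open>f\<close> is a fit frozen together with its training
  data.\<close>

lemma nn_integral_exp_aligned_noise_le:
  "(\<integral>\<^sup>+\<omega>. ennreal (exp (4 / (9 * \<sigma>\<^sup>2) * (aligned_noise A (\<lambda>i. \<epsilon> \<omega> $ i) f)\<^sup>2)) \<partial>P) \<le> 2"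
proof (cases "L2_set f A = 0")
  case True
  then show ?thesis by (simp add: aligned_noise_def emeasure_space_1)
next
  case False
  then have pos: "L2_set f A > 0" using L2_set_nonneg[of f A] by linarith
  have "L2_set (\<lambda>i. 1 / L2_set f A * f i) A = 1"
    using pos by (subst L2_set_right_distrib[symmetric]) auto
  then have "distributed P lborel (\<lambda>\<omega>. \<Sum>i\<in>A. 1 / L2_set f A * f i * \<epsilon> \<omega> $ i) (normal_density 0 \<sigma>)"
    using distributed_combination[of "\<lambda>i. 1 / L2_set f A * f i" A] by simp
  from distributed_nn_integral[OF this, of "\<lambda>x. ennreal (exp (4 / (9 * \<sigma>\<^sup>2) * (max 0 x)\<^sup>2))"]
  have "(\<integral>\<^sup>+\<omega>. ennreal (exp (4 / (9 * \<sigma>\<^sup>2) * (max 0 (\<Sum>i\<in>A. 1 / L2_set f A * f i * \<epsilon> \<omega> $ i))\<^sup>2)) \<partial>P) = 2"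
    using nn_integral_exp_positive_part_normal[OF \<sigma>_pos] by simp
  moreover have "(\<Sum>i\<in>A. 1 / L2_set f A * f i * \<epsilon> \<omega> $ i) = (\<Sum>i\<in>A. \<epsilon> \<omega> $ i * f i) / L2_set f A" for \<omega>
    by (simp add: sum_divide_distrib mult_ac)
  ultimately show ?thesis by (simp only: aligned_noise_def)
qed

text \<open>
  The factor \<open>4 / 9\<close> gives the positive part of the Gaussian an exponential moment equal to
  \<open>2\<close>, so the maximum of \<open>N\<close> of them has second moment at most
  \<open>9 / 4 * ln (2 * N)\<close>, which is turned into a multiple of \<open>ln (N + 1)\<close>
  because \<open>(2 * N) ^ 3 \<le> (N + 1) ^ 4\<close>.
\<close>

lemma nn_integral_Max_aligned_noise_le:
  fixes f :: "nat \<Rightarrow> 'n \<Rightarrow> real"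
  assumes f0: "\<And>i. i \<in> A \<Longrightarrow> f 0 i = 0"
  shows "(\<integral>\<^sup>+\<omega>. ennreal ((Max ((\<lambda>k. aligned_noise A (\<lambda>i. \<epsilon> \<omega> $ i) (f k)) ` {..N}))\<^sup>2) \<partial>P)
    \<le> ennreal (3 * \<sigma>\<^sup>2 * ln (real N + 1))"
proof (cases "N = 0")
  case True
  then show ?thesis using f0 by (simp add: aligned_noise_zero)
next
  case False
  define g where "g k \<omega> = aligned_noise A (\<lambda>i. \<epsilon> \<omega> $ i) (f k)" for k \<omega>
  have [measurable]: "g k \<in> borel_measurable P" for k unfolding g_def by measurable
  define c where "c = 9 * \<sigma>\<^sup>2 / 4"
  have c: "c > 0" using \<sigma>_pos by (simp add: c_def)
  have c': "4 / (9 * \<sigma>\<^sup>2) = 1 / c" by (simp add: c_def)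
  \<comment> \<open>Index 0 is left out: the zero fit has aligned noise 0, which is dominated by
    index 1. The union bound then runs over \<open>N\<close> directions instead of
    \<open>N + 1\<close>.\<close>
  define S where "S \<omega> = (\<Sum>k=1..N. exp (1 / c * (g k \<omega>)\<^sup>2))" for \<omega>
  have [measurable]: "S \<in> borel_measurable P" unfolding S_def by measurable
  have S0: "0 \<le> S \<omega>" for \<omega> by (simp add: S_def sum_nonneg)
  have n: "N \<ge> 1" using False by simp
  have "(\<integral>\<^sup>+\<omega>. ennreal (S \<omega>) \<partial>P) = (\<Sum>k=1..N. \<integral>\<^sup>+\<omega>. ennreal (exp (1 / c * (g k \<omega>)\<^sup>2)) \<partial>P)"
    unfolding S_def by (subst sum_ennreal[symmetric]) (auto simp: nn_integral_sum simp del: sum_ennreal)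
  also have "\<dots> \<le> (\<Sum>k=1..N. 2)"
    using nn_integral_exp_aligned_noise_le[of A] by (intro sum_mono) (simp only: g_def c')
  also have "\<dots> = (\<Sum>k=1..N. ennreal 2)" by simp
  also have "\<dots> = ennreal (\<Sum>k=1..N. 2)" by (rule sum_ennreal) simp
  also have "\<dots> = ennreal (2 * N)" by (simp add: mult.commute)
  finally have ES: "(\<integral>\<^sup>+\<omega>. ennreal (S \<omega>) \<partial>P) \<le> ennreal (2 * N)" .
  have "(\<integral>\<^sup>+\<omega>. ennreal (c / (2 * N) * S \<omega>) \<partial>P) = ennreal (c / (2 * N)) * (\<integral>\<^sup>+\<omega>. ennreal (S \<omega>) \<partial>P)"
    using c n S0 by (subst nn_integral_cmult[symmetric]) (auto simp: ennreal_mult[symmetric])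
  also have "\<dots> \<le> ennreal (c / (2 * N)) * ennreal (2 * N)" by (intro mult_left_mono ES) simp
  also have "\<dots> = ennreal c" using c n by (simp add: ennreal_mult[symmetric])
  finally have ES': "(\<integral>\<^sup>+\<omega>. ennreal (c / (2 * N) * S \<omega>) \<partial>P) \<le> ennreal c" .
  have "(\<integral>\<^sup>+\<omega>. ennreal ((Max ((\<lambda>k. g k \<omega>) ` {..N}))\<^sup>2) \<partial>P) \<le> ennreal (c * (ln (2 * N) - 1) + c)"
  proof (rule nn_integral_le_shift[OF _ _ _ _ ES'])
    fix \<omega>
    have *: "(g k \<omega>)\<^sup>2 \<le> c * (ln (2 * N) - 1) + c / (2 * N) * S \<omega>" if k: "1 \<le> k" "k \<le> N" for k
    proof -
      have S: "exp (1 / c * (g k \<omega>)\<^sup>2) \<le> S \<omega>"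
        unfolding S_def using k by (intro member_le_sum[of k _ "\<lambda>k. exp (1 / c * (g k \<omega>)\<^sup>2)"]) auto
      then have S1: "S \<omega> > 0" by (meson exp_gt_zero less_le_trans)
      have "1 / c * (g k \<omega>)\<^sup>2 \<le> ln (S \<omega>)" using S S1 by (simp add: ln_ge_iff)
      also have "\<dots> = ln (2 * N) + ln (S \<omega> / (2 * N))" using S1 n by (simp add: ln_div)
      also have "\<dots> \<le> ln (2 * N) + (S \<omega> / (2 * N) - 1)"
        using S1 n by (intro add_left_mono ln_le_minus_one) simp
      finally have "c * (1 / c * (g k \<omega>)\<^sup>2) \<le> c * (ln (2 * N) + (S \<omega> / (2 * N) - 1))"
        using c by (intro mult_left_mono) auto
      then show ?thesis using c by (simp add: algebra_simps)
    qed
    have "Max ((\<lambda>k. g k \<omega>) ` {..N}) \<in> (\<lambda>k. g k \<omega>) ` {..N}" by (intro Max_in) auto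
    then obtain k where k: "k \<le> N" "Max ((\<lambda>k. g k \<omega>) ` {..N}) = g k \<omega>" by (elim imageE) simp
    have "g 0 \<omega> = 0" using f0 by (simp add: g_def aligned_noise_zero)
    then have "(g 0 \<omega>)\<^sup>2 \<le> (g 1 \<omega>)\<^sup>2" by simp
    with *[of 1] *[of k] k n
    show "(Max ((\<lambda>k. g k \<omega>) ` {..N}))\<^sup>2 \<le> c * (ln (2 * N) - 1) + c / (2 * N) * S \<omega>"
      by (cases "k = 0") auto
  qed (use S0 c n in auto)
  also have "c * (ln (2 * N) - 1) + c = \<sigma>\<^sup>2 * (9 / 4 * ln (2 * N))" by (simp add: right_diff_distrib) (simp add: c_def)
  also have "\<dots> \<le> \<sigma>\<^sup>2 * (3 * ln (real N + 1))" 
    using ln_double_le[OF n] by (intro mult_left_mono) auto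
  also have "\<dots> = 3 * \<sigma>\<^sup>2 * ln (real N + 1)" by simp
  finally show ?thesis by (simp add: g_def ennreal_leI)
qed

section \<open>Moments of the noise and of its squared norm\<close>

lemma noise_moment:
  shows "integrable P (\<lambda>\<omega>. (\<epsilon> \<omega> $ i) ^ (2 * k))"
    and "expectation (\<lambda>\<omega>. (\<epsilon> \<omega> $ i) ^ (2 * k)) = fact (2 * k) / ((2 / \<sigma>\<^sup>2) ^ k * fact k)"
  using normal_moment_even[OF \<sigma>_pos, of 0 k]
    distributed_integral[OF distributed_noise[of i], of "\<lambda>x. x ^ (2 * k)"]
    distributed_integrable[OF distributed_noise[of i], of "\<lambda>x. x ^ (2 * k)"]
  by (auto simp: has_bochner_integral_iff)

lemma noise_second_moment:
  "integrable P (\<lambda>\<omega>. (\<epsilon> \<omega> $ i)\<^sup>2)" "expectation (\<lambda>\<omega>. (\<epsilon> \<omega> $ i)\<^sup>2) = \<sigma>\<^sup>2"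
  using noise_moment[of i 1] \<sigma>_pos by auto

lemma noise_mean:
  "integrable P (\<lambda>\<omega>. \<epsilon> \<omega> $ i)" "expectation (\<lambda>\<omega>. \<epsilon> \<omega> $ i) = 0"
proof -
  show "integrable P (\<lambda>\<omega>. \<epsilon> \<omega> $ i)"
    by (rule square_integrable_imp_integrable[OF noise_component_measurable noise_second_moment(1)])
  show "expectation (\<lambda>\<omega>. \<epsilon> \<omega> $ i) = 0"
    using normal_distributed_expectation[OF \<sigma>_pos distributed_noise] .
qed

lemma nn_integral_norm_noise_sq:
  "(\<integral>\<^sup>+\<omega>. ennreal ((norm (\<epsilon> \<omega>))\<^sup>2) \<partial>P) = ennreal (real CARD('n) * \<sigma>\<^sup>2)"
proof -
  have int: "integrable P (\<lambda>\<omega>. (norm (\<epsilon> \<omega>))\<^sup>2)"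
    unfolding norm_sq_vec by (intro Bochner_Integration.integrable_sum noise_second_moment)
  have "expectation (\<lambda>\<omega>. (norm (\<epsilon> \<omega>))\<^sup>2) = real CARD('n) * \<sigma>\<^sup>2"
    unfolding norm_sq_vec by (simp add: noise_second_moment)
  then show ?thesis using int by (subst nn_integral_eq_integral) auto
qed

text \<open>The deviation is an average of \<open>n\<close> independent centered variables of
  variance \<open>2 * \<sigma> ^ 4\<close>, because the fourth moment of the noise is
  \<open>3 * \<sigma> ^ 4\<close>. Its second moment is \<open>2 * \<sigma> ^ 4 / n\<close>, and
  Cauchy-Schwarz against 1 gives the first absolute moment.\<close>

lemma nn_integral_noise_variance_error:
  defines "n \<equiv> real CARD('n)"
  shows "(\<integral>\<^sup>+\<omega>. ennreal \<bar>(norm (\<epsilon> \<omega>))\<^sup>2 / n - \<sigma>\<^sup>2\<bar> \<partial>P) \<le> ennreal (\<sigma>\<^sup>2 * sqrt (2 / n))"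
proof -
  have n: "n > 0" by (simp add: n_def)
  define h where "h i \<omega> = (\<epsilon> \<omega> $ i)\<^sup>2 - \<sigma>\<^sup>2" for i \<omega>
  have [measurable]: "h i \<in> borel_measurable P" for i unfolding h_def by measurable
  have h1: "integrable P (h i)" "expectation (h i) = 0" for i
    unfolding h_def using noise_second_moment[of i] by (auto simp: prob_space)
  have sq: "(h i \<omega>)\<^sup>2 = (\<epsilon> \<omega> $ i) ^ (2 * 2) - 2 * \<sigma>\<^sup>2 * (\<epsilon> \<omega> $ i)\<^sup>2 + \<sigma> ^ 4" for i \<omega>
    by (simp add: h_def power2_eq_square power4_eq_xxxx algebra_simps)
  have fourth: "expectation (\<lambda>\<omega>. (\<epsilon> \<omega> $ i) ^ (2 * 2)) = 3 * \<sigma> ^ 4" for i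
    unfolding noise_moment using \<sigma>_pos by (simp add: fact_numeral field_simps)
  have h2: "integrable P (\<lambda>\<omega>. (h i \<omega>)\<^sup>2)" "expectation (\<lambda>\<omega>. (h i \<omega>)\<^sup>2) = 2 * \<sigma> ^ 4" for i
    unfolding sq using noise_second_moment[of i] noise_moment(1)[of i 2] fourth[of i]
    by (auto simp: prob_space power2_eq_square power4_eq_xxxx)
  have cross: "integrable P (\<lambda>\<omega>. h i \<omega> * h j \<omega>)"
      "expectation (\<lambda>\<omega>. h i \<omega> * h j \<omega>) = (if i = j then 2 * \<sigma> ^ 4 else 0)" for i j
  proof -
    have "indep_var borel (h i) borel (h j)" if "i \<noteq> j"
    proof -
      have "indep_vars (\<lambda>_. borel) h UNIV"
        unfolding h_def by (rule indep_vars_compose2[OF indep_noise, of "\<lambda>i x. x\<^sup>2 - \<sigma>\<^sup>2"]) auto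
      from indep_var_compose[OF indep_var_restrict[OF this, of "{i}" "{j}"], of "\<lambda>f. f i" borel "\<lambda>f. f j" borel] that
      show ?thesis by (simp add: comp_def)
    qed
    note ij = indep_var_integrable[OF this h1(1) h1(1)] indep_var_lebesgue_integral[OF this h1(1) h1(1)]
    show "integrable P (\<lambda>\<omega>. h i \<omega> * h j \<omega>)"
      using ij(1) h2(1)[of i] by (cases "i = j") (auto simp: power2_eq_square)
    show "expectation (\<lambda>\<omega>. h i \<omega> * h j \<omega>) = (if i = j then 2 * \<sigma> ^ 4 else 0)"
      using ij(2) h2(2)[of i] by (cases "i = j") (auto simp: power2_eq_square h1)
  qed
  define V where "V \<omega> = \<bar>(norm (\<epsilon> \<omega>))\<^sup>2 / n - \<sigma>\<^sup>2\<bar>" for \<omega>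
  have [measurable]: "V \<in> borel_measurable P" unfolding V_def by measurable
  have "(norm (\<epsilon> \<omega>))\<^sup>2 / n - \<sigma>\<^sup>2 = (\<Sum>i\<in>UNIV. h i \<omega>) / n" for \<omega>
    using n by (simp add: norm_sq_vec h_def sum_subtractf n_def field_simps)
  then have V: "(V \<omega>)\<^sup>2 = (\<Sum>i\<in>UNIV. \<Sum>j\<in>UNIV. h i \<omega> * h j \<omega>) / n\<^sup>2" for \<omega>
    by (simp add: V_def power_divide) (simp add: power2_eq_square sum_product)
  have "(\<integral>\<^sup>+\<omega>. ennreal ((V \<omega>)\<^sup>2) \<partial>P) = ennreal (expectation (\<lambda>\<omega>. (V \<omega>)\<^sup>2))"
  proof (rule nn_integral_eq_integral)
    show "integrable P (\<lambda>\<omega>. (V \<omega>)\<^sup>2)" by (simp add: V cross)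
  qed simp
  also have "expectation (\<lambda>\<omega>. (V \<omega>)\<^sup>2) = 2 * \<sigma> ^ 4 / n"
    using n by (simp add: V cross) (simp add: n_def field_simps power2_eq_square)
  finally have "(\<integral>\<^sup>+\<omega>. ennreal ((V \<omega>)\<^sup>2) \<partial>P) \<le> ennreal (2 * \<sigma> ^ 4 / n)" by simp
  then have "(\<integral>\<^sup>+\<omega>. ennreal (V \<omega> * 1) \<partial>P) \<le> ennreal (sqrt (2 * \<sigma> ^ 4 / n * 1))"
    using n by (intro nn_integral_mult_le_sqrt) (auto simp: V_def emeasure_space_1)
  also have "2 * \<sigma> ^ 4 / n * 1 = (\<sigma>\<^sup>2)\<^sup>2 * (2 / n)" by simp
  also have "sqrt \<dots> = \<sigma>\<^sup>2 * sqrt (2 / n)" by (simp only: real_sqrt_mult real_sqrt_abs) simp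
  finally show ?thesis by (simp add: V_def)
qed

end

section \<open>A single fold\<close>

lemma fold_rule_measurable:
  assumes "fold_lasso_rule X A b" "0 \<le> K"
  shows "b K \<in> measurable (data_space A) borel"
proof -
  have "(\<lambda>y. (K, y)) \<in> measurable (data_space A) (restrict_space borel {0..} \<Otimes>\<^sub>M data_space A)"
    using assms by (intro measurable_Pair measurable_restrict_space2 measurable_const) auto
  moreover have "(\<lambda>(K, y). b K y) \<in> borel_measurable (restrict_space borel {0..} \<Otimes>\<^sub>M data_space A)"
    using assms unfolding fold_lasso_rule_def by blast
  ultimately have "(\<lambda>y. case (K, y) of (K, y) \<Rightarrow> b K y) \<in> measurable (data_space A) borel"
    by (rule measurable_compose)
  then show ?thesis by simp
qed

lemma fold_rule_arg_min:
  assumes "fold_lasso_rule X A b" "0 \<le> K" "y \<in> space (data_space A)"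
  shows "is_arg_min (\<lambda>\<beta>. \<Sum>i\<in>A. (y i - (X *v \<beta>) $ i)\<^sup>2) (\<lambda>\<beta>. l1_norm \<beta> \<le> K) (b K y)"
    and "l1_norm (b K y) \<le> K"
  using assms by (auto simp: fold_lasso_rule_def is_arg_min_def)

lemma prediction_measurable [measurable (raw)]:
  fixes X :: "real^'p^'n"
  assumes "f \<in> borel_measurable M"
  shows "(\<lambda>x. (X *v f x) $ i) \<in> borel_measurable M"
proof -
  have "(\<lambda>v. (X *v v) $ i) \<in> borel_measurable borel"
    unfolding matrix_vector_mult_def
    by (intro borel_measurable_continuous_onI) (auto intro!: continuous_intros)
  from measurable_compose[OF assms this] show ?thesis .
qed

text \<open>The index range of the maximum is random. For a constant range measurability is
  standard, and the countably many values of \<open>N\<close> are glued together.\<close>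

lemma Max_aligned_noise_measurable:
  fixes A :: "'n::finite set" and f :: "'a \<Rightarrow> nat \<Rightarrow> 'n \<Rightarrow> real"
  assumes N: "N \<in> measurable M (count_space UNIV)"
    and [measurable]: "\<And>i. i \<in> A \<Longrightarrow> (\<lambda>x. e x i) \<in> borel_measurable M"
      "\<And>k i. i \<in> A \<Longrightarrow> (\<lambda>x. f x k i) \<in> borel_measurable M"
  shows "(\<lambda>x. Max ((\<lambda>k. aligned_noise A (e x) (f x k)) ` {..N x})) \<in> borel_measurable M"
proof -
  have "(\<lambda>x. Max ((\<lambda>k. aligned_noise A (e x) (f x k)) ` {..n})) \<in> borel_measurable M" for n :: nat
    by (intro borel_measurable_Max borel_measurable_aligned_noise) auto
  from measurable_compose_countable[OF this N] show ?thesis .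
qed

text \<open>\<open>J\<close> is the half on which the fits are tested, while \<open>b\<close> and
  \<open>\<nu>\<close> receive the data on its complement. Both folds are instances:
  \<open>I\<close> with \<open>b2\<close> and \<open>\<nu>1\<close>, and \<open>- I\<close> with
  \<open>b1\<close> and \<open>\<nu>2\<close>.\<close>

locale lasso_fold = gaussian_noise P \<epsilon> \<sigma> for P :: "'a measure" and \<epsilon> :: "'a \<Rightarrow> real^'n" and \<sigma> +
  fixes X :: "real^'p^'n" and m :: "real^'n" and J :: "'a \<Rightarrow> 'n set"
    and b :: "'n set \<Rightarrow> real \<Rightarrow> ('n \<Rightarrow> real) \<Rightarrow> real^'p" and \<nu> :: "'n set \<Rightarrow> ('n \<Rightarrow> real) \<Rightarrow> nat"
    and \<delta> :: real
  assumes \<delta>_pos: "0 < \<delta>"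
    and indep_split: "indep_pair (count_space UNIV) J borel \<epsilon>"
    and rule: "\<And>A. fold_lasso_rule X A (b A)"
    and \<nu>_measurable: "\<And>A. \<nu> A \<in> measurable (data_space A) (count_space UNIV)"
begin

definition train :: "'n set \<Rightarrow> real^'n \<Rightarrow> 'n \<Rightarrow> real" where
  "train A e = data_on (- A) (m + e)"

definition grid_max :: "'n set \<Rightarrow> real^'n \<Rightarrow> nat" where
  "grid_max A e = \<nu> (- A) (train A e)"

definition fit :: "'n set \<Rightarrow> real^'n \<Rightarrow> nat \<Rightarrow> 'n \<Rightarrow> real" where
  "fit A e k i = (X *v b (- A) (real k * \<delta>) (train A e)) $ i"

definition max_aligned :: "'n set \<Rightarrow> real^'n \<Rightarrow> real" where
  "max_aligned A e = Max ((\<lambda>k. aligned_noise A (\<lambda>i. e $ i) (fit A e k)) ` {..grid_max A e})"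

text \<open>The guard depends on the training data only, so it does not disturb the mean; the value
  0 for a grid that is too short keeps the later risk bound nonnegative.\<close>

definition comparison_noise :: "nat \<Rightarrow> 'n set \<Rightarrow> real^'n \<Rightarrow> real" where
  "comparison_noise k A e = (if k \<le> grid_max A e then \<Sum>i\<in>A. e $ i * fit A e k i else 0)"

lemma J_measurable [measurable]: "J \<in> measurable P (count_space UNIV)"
  using indep_split by (simp add: indep_pair_def)

lemma train_space: "train A e \<in> space (data_space (- A))"
  by (simp add: train_def data_on_def space_PiM)

lemma train_measurable [measurable]: "train A \<in> measurable borel (data_space (- A))"
  unfolding train_def[abs_def] data_on_def by (intro measurable_restrict) simp

lemma grid_max_measurable [measurable]: "grid_max A \<in> measurable borel (count_space UNIV)"
  unfolding grid_max_def[abs_def] by (rule measurable_compose[OF train_measurable \<nu>_measurable])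

lemma b_measurable [measurable]: "b A (real k * \<delta>) \<in> measurable (data_space A) borel"
  using \<delta>_pos by (intro fold_rule_measurable[OF rule]) simp

lemma fit_measurable [measurable]: "(\<lambda>e. fit A e k i) \<in> borel_measurable borel"
  unfolding fit_def by measurable

lemma max_aligned_measurable [measurable]: "max_aligned A \<in> borel_measurable borel"
  unfolding max_aligned_def[abs_def] by (rule Max_aligned_noise_measurable) auto

lemma comparison_noise_measurable [measurable]: "comparison_noise k A \<in> borel_measurable borel"
  unfolding comparison_noise_def[abs_def] by measurable

lemma split_measurable:
  assumes "\<And>A. F A \<in> measurable borel K"
  shows "(\<lambda>\<omega>. F (J \<omega>) (\<epsilon> \<omega>)) \<in> measurable P K"
  by (rule measurable_compose_countable[OF measurable_compose[OF noise_measurable assms] J_measurable])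

lemma split_pair_measurable:
  fixes F :: "'n set \<Rightarrow> real^'n \<Rightarrow> 'k"
  assumes "\<And>A. F A \<in> measurable borel K"
  shows "(\<lambda>(A, e). F A e) \<in> measurable (count_space UNIV \<Otimes>\<^sub>M borel) K"
  using assms by (intro measurable_pair_measure_countable1 countableI_type) simp_all

text \<open>The half may be frozen: as it is independent of the noise, an inequality between the
  means for every fixed \<open>A\<close> averages to one for the random half.\<close>

lemma split_nn_integral_mono:
  fixes F G :: "'n set \<Rightarrow> real^'n \<Rightarrow> ennreal"
  assumes "\<And>A. F A \<in> borel_measurable borel" "\<And>A. G A \<in> borel_measurable borel"
    and le: "\<And>A. (\<integral>\<^sup>+\<omega>. F A (\<epsilon> \<omega>) \<partial>P) \<le> (\<integral>\<^sup>+\<omega>. G A (\<epsilon> \<omega>) \<partial>P)"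
  shows "(\<integral>\<^sup>+\<omega>. F (J \<omega>) (\<epsilon> \<omega>) \<partial>P) \<le> (\<integral>\<^sup>+\<omega>. G (J \<omega>) (\<epsilon> \<omega>) \<partial>P)"
  using indep_pair_nn_integral_iterated[OF indep_split split_pair_measurable, of F]
    indep_pair_nn_integral_iterated[OF indep_split split_pair_measurable, of G] assms
  by (simp add: nn_integral_mono)

lemma split_nn_integral_le:
  fixes F :: "'n set \<Rightarrow> real^'n \<Rightarrow> ennreal"
  assumes "\<And>A. F A \<in> borel_measurable borel" and "\<And>A. (\<integral>\<^sup>+\<omega>. F A (\<epsilon> \<omega>) \<partial>P) \<le> c"
  shows "(\<integral>\<^sup>+\<omega>. F (J \<omega>) (\<epsilon> \<omega>) \<partial>P) \<le> c"
  using split_nn_integral_mono[of F "\<lambda>_ _. c"] assms by (simp add: emeasure_space_1)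

lemma indep_response: "indep_vars (\<lambda>_. borel) (\<lambda>i \<omega>. (m + \<epsilon> \<omega>) $ i) UNIV"
  using indep_vars_compose2[OF indep_noise, of "\<lambda>i x. m $ i + x"] by simp

text \<open>The directions and their number are functions of the responses on \<open>- A\<close>.
  With these frozen, the maximal inequality for deterministic directions applies to the noise on
  \<open>A\<close>, and its right-hand side is integrated over the training data.\<close>

lemma nn_integral_max_aligned_le_fixed:
  "(\<integral>\<^sup>+\<omega>. ennreal ((max_aligned A (\<epsilon> \<omega>))\<^sup>2) \<partial>P) \<le> (\<integral>\<^sup>+\<omega>. ennreal (3 * \<sigma>\<^sup>2 * ln (real (grid_max A (\<epsilon> \<omega>)) + 1)) \<partial>P)"
proof -
  define f where "f w k i = (X *v b (- A) (real k * \<delta>) w) $ i" for w k i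
  \<comment> \<open>\<open>w\<close> and \<open>z\<close> are the two independent blocks of
    responses; subtracting \<open>m\<close> from \<open>z\<close> recovers the noise on
    \<open>A\<close>.\<close>
  define F where "F = (\<lambda>(w, z). ennreal ((Max ((\<lambda>k. aligned_noise A (\<lambda>i. z i - m $ i) (f w k)) ` {..\<nu> (- A) w}))\<^sup>2))"
  have Fm: "F \<in> borel_measurable (data_space (- A) \<Otimes>\<^sub>M data_space A)"
  proof -
    have "(\<lambda>x. Max ((\<lambda>k. aligned_noise A (\<lambda>i. snd x i - m $ i) (f (fst x) k)) ` {..\<nu> (- A) (fst x)}))
      \<in> borel_measurable (data_space (- A) \<Otimes>\<^sub>M data_space A)"
    proof (rule Max_aligned_noise_measurable)
      show "(\<lambda>x. \<nu> (- A) (fst x)) \<in> data_space (- A) \<Otimes>\<^sub>M data_space A \<rightarrow>\<^sub>M count_space UNIV"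
        by (rule measurable_compose[OF measurable_fst \<nu>_measurable])
      show "(\<lambda>x. f (fst x) k i) \<in> borel_measurable (data_space (- A) \<Otimes>\<^sub>M data_space A)" for k i
        unfolding f_def by measurable
    qed measurable
    then show ?thesis unfolding F_def case_prod_beta by measurable
  qed
  let ?W = "\<lambda>\<omega>. restrict (\<lambda>i. (m + \<epsilon> \<omega>) $ i) (- A)" and ?Z = "\<lambda>\<omega>. restrict (\<lambda>i. (m + \<epsilon> \<omega>) $ i) A"
  have ind: "indep_var (data_space (- A)) ?W (data_space A) ?Z"
    by (rule indep_var_restrict[OF indep_response]) auto
  have W: "?W \<omega> = train A (\<epsilon> \<omega>)" for \<omega> by (simp add: train_def data_on_def)
  have eq: "aligned_noise A (\<lambda>i. ?Z \<omega> i - m $ i) g = aligned_noise A (\<lambda>i. \<epsilon> \<omega> $ i) g" for \<omega> g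
    by (rule aligned_noise_cong) auto
  have "(\<integral>\<^sup>+\<omega>. ennreal ((max_aligned A (\<epsilon> \<omega>))\<^sup>2) \<partial>P) = (\<integral>\<^sup>+\<omega>. F (?W \<omega>, ?Z \<omega>) \<partial>P)"
    unfolding F_def prod.case eq W max_aligned_def grid_max_def f_def fit_def ..
  also have "\<dots> = (\<integral>\<^sup>+\<omega>'. \<integral>\<^sup>+\<omega>. F (?W \<omega>', ?Z \<omega>) \<partial>P \<partial>P)"
    by (rule indep_pair_nn_integral_iterated[OF indep_var_imp_indep_pair[OF ind] Fm])
  also have "\<dots> \<le> (\<integral>\<^sup>+\<omega>'. ennreal (3 * \<sigma>\<^sup>2 * ln (real (grid_max A (\<epsilon> \<omega>')) + 1)) \<partial>P)"
  proof (rule nn_integral_mono)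
    fix \<omega>'
    have "l1_norm (b (- A) 0 (train A (\<epsilon> \<omega>'))) \<le> 0"
      by (rule fold_rule_arg_min(2)[OF rule _ train_space]) simp
    then have "b (- A) 0 (train A (\<epsilon> \<omega>')) = 0" by (rule l1_norm_le_0D)
    then have "f (train A (\<epsilon> \<omega>')) 0 i = 0" for i by (simp add: f_def)
    then show "(\<integral>\<^sup>+\<omega>. F (?W \<omega>', ?Z \<omega>) \<partial>P) \<le> ennreal (3 * \<sigma>\<^sup>2 * ln (real (grid_max A (\<epsilon> \<omega>')) + 1))"
      unfolding F_def prod.case eq W grid_max_def by (rule nn_integral_Max_aligned_noise_le)
  qed
  finally show ?thesis .
qed

lemma nn_integral_max_aligned_le:
  "(\<integral>\<^sup>+\<omega>. ennreal ((max_aligned (J \<omega>) (\<epsilon> \<omega>))\<^sup>2) \<partial>P)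
    \<le> (\<integral>\<^sup>+\<omega>. ennreal (3 * \<sigma>\<^sup>2 * ln (real (grid_max (J \<omega>) (\<epsilon> \<omega>)) + 1)) \<partial>P)"
  by (rule split_nn_integral_mono[of "\<lambda>A e. ennreal ((max_aligned A e)\<^sup>2)"
        "\<lambda>A e. ennreal (3 * \<sigma>\<^sup>2 * ln (real (grid_max A e) + 1))"])
    (measurable, rule nn_integral_max_aligned_le_fixed)

text \<open>The noise at a test index is centered and independent of the training data; boundedness
  of \<open>g\<close> supplies the integrability.\<close>

lemma expectation_noise_times_train:
  assumes i: "i \<in> A" and g[measurable]: "g \<in> borel_measurable (data_space (- A))"
    and bd: "\<And>w. w \<in> space (data_space (- A)) \<Longrightarrow> \<bar>g w\<bar> \<le> C"
  shows "integrable P (\<lambda>\<omega>. \<epsilon> \<omega> $ i * g (train A (\<epsilon> \<omega>)))"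
    and "expectation (\<lambda>\<omega>. \<epsilon> \<omega> $ i * g (train A (\<epsilon> \<omega>))) = 0"
proof -
  let ?W = "\<lambda>\<omega>. restrict (\<lambda>i. (m + \<epsilon> \<omega>) $ i) (- A)" and ?Z = "\<lambda>\<omega>. restrict (\<lambda>i. (m + \<epsilon> \<omega>) $ i) {i}"
  have "indep_var (data_space {i}) ?Z (data_space (- A)) ?W"
    using i by (intro indep_var_restrict[OF indep_response]) auto
  then have "indep_var borel ((\<lambda>z. z i - m $ i) \<circ> ?Z) borel (g \<circ> ?W)"
    by (rule indep_var_compose) measurable
  then have ind: "indep_var borel (\<lambda>\<omega>. \<epsilon> \<omega> $ i) borel (\<lambda>\<omega>. g (train A (\<epsilon> \<omega>)))"
    by (simp add: comp_def train_def data_on_def)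
  have "integrable P (\<lambda>\<omega>. g (train A (\<epsilon> \<omega>)))"
    by (rule integrable_const_bound[of _ C]) (auto intro!: bd train_space)
  note * = ind noise_mean(1)[of i] this
  show "integrable P (\<lambda>\<omega>. \<epsilon> \<omega> $ i * g (train A (\<epsilon> \<omega>)))" by (rule indep_var_integrable[OF *])
  show "expectation (\<lambda>\<omega>. \<epsilon> \<omega> $ i * g (train A (\<epsilon> \<omega>))) = 0"
    using indep_var_lebesgue_integral[OF *] noise_mean(2)[of i] by simp
qed

text \<open>The l1 constraint bounds each prediction by the radius times the largest entry of the
  design, uniformly in the data and in the half.\<close>

lemma prediction_bounded:
  obtains C where "\<And>A w i. w \<in> space (data_space A) \<Longrightarrow> \<bar>(X *v b A (real k * \<delta>) w) $ i\<bar> \<le> C"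
proof -
  define M where "M = Max (range (\<lambda>(i, j). \<bar>X $ i $ j\<bar>))"
  have M: "\<bar>X $ i $ j\<bar> \<le> M" for i j
    unfolding M_def by (intro Max_ge) (auto intro!: image_eqI[of _ _ "(i, j)"])
  have M0: "0 \<le> M" using M[of undefined undefined] by linarith
  have "\<bar>(X *v u) $ i\<bar> \<le> l1_norm u * M" for u i
  proof -
    have "\<bar>(X *v u) $ i\<bar> \<le> (\<Sum>j\<in>UNIV. \<bar>X $ i $ j\<bar> * \<bar>u $ j\<bar>)"
      unfolding matrix_vector_mult_def by (simp add: order_trans[OF sum_abs] abs_mult)
    also have "\<dots> \<le> (\<Sum>j\<in>UNIV. M * \<bar>u $ j\<bar>)" by (intro sum_mono mult_right_mono M) auto
    finally show ?thesis by (simp add: l1_norm_def sum_distrib_left mult.commute)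
  qed
  moreover have "l1_norm (b A (real k * \<delta>) w) * M \<le> real k * \<delta> * M" if "w \<in> space (data_space A)" for A w
    using fold_rule_arg_min(2)[OF rule _ that, of "real k * \<delta>"] \<delta>_pos M0 by (intro mult_right_mono) auto
  ultimately show ?thesis by (intro that[of "real k * \<delta> * M"]) (meson order_trans)
qed

text \<open>For a fixed half, the guard and the fit form one bounded function of the training data,
  multiplied by noise at test indices. The integrable majorant does not mention the half, so it also
  serves for the random one.\<close>

lemma comparison_noise_centered:
  shows "integrable P (\<lambda>\<omega>. comparison_noise k (J \<omega>) (\<epsilon> \<omega>))"
    and "expectation (\<lambda>\<omega>. comparison_noise k (J \<omega>) (\<epsilon> \<omega>)) = 0"
proof -
  obtain C where C: "\<And>A w i. w \<in> space (data_space A) \<Longrightarrow> \<bar>(X *v b A (real k * \<delta>) w) $ i\<bar> \<le> C"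
    using prediction_bounded[of k] by blast
  have C0: "0 \<le> C" using C[OF train_space] by (meson abs_ge_zero order_trans)
  have fitC: "\<bar>fit A e k i\<bar> \<le> C" for A e i unfolding fit_def by (rule C[OF train_space])
  have bound: "\<bar>comparison_noise k A e\<bar> \<le> (\<Sum>i\<in>UNIV. \<bar>e $ i\<bar> * C)" for A e
  proof -
    have "\<bar>comparison_noise k A e\<bar> \<le> \<bar>\<Sum>i\<in>A. e $ i * fit A e k i\<bar>" by (simp add: comparison_noise_def)
    also have "\<dots> \<le> (\<Sum>i\<in>A. \<bar>e $ i\<bar> * \<bar>fit A e k i\<bar>)" by (rule order_trans[OF sum_abs]) (simp add: abs_mult)
    also have "\<dots> \<le> (\<Sum>i\<in>A. \<bar>e $ i\<bar> * C)" by (intro sum_mono mult_left_mono fitC) auto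
    also have "\<dots> \<le> (\<Sum>i\<in>UNIV. \<bar>e $ i\<bar> * C)" using C0 by (intro sum_mono2) auto
    finally show ?thesis .
  qed
  show int: "integrable P (\<lambda>\<omega>. comparison_noise k (J \<omega>) (\<epsilon> \<omega>))"
  proof (rule Bochner_Integration.integrable_bound)
    show "integrable P (\<lambda>\<omega>. \<Sum>i\<in>UNIV. \<bar>\<epsilon> \<omega> $ i\<bar> * C)"
      using noise_mean(1) by (intro Bochner_Integration.integrable_sum) auto
    show "(\<lambda>\<omega>. comparison_noise k (J \<omega>) (\<epsilon> \<omega>)) \<in> borel_measurable P"
      by (rule split_measurable) measurable
    show "AE \<omega> in P. norm (comparison_noise k (J \<omega>) (\<epsilon> \<omega>)) \<le> norm (\<Sum>i\<in>UNIV. \<bar>\<epsilon> \<omega> $ i\<bar> * C)"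
      using bound by (intro AE_I2) (auto intro: order_trans[OF _ abs_ge_self])
  qed
  have fixed: "expectation (\<lambda>\<omega>. comparison_noise k A (\<epsilon> \<omega>)) = 0" for A
  proof -
    define g where "g i w = (if k \<le> \<nu> (- A) w then (X *v b (- A) (real k * \<delta>) w) $ i else 0)" for i w
    have [measurable]: "g i \<in> borel_measurable (data_space (- A))" for i
      using \<nu>_measurable[of "- A", measurable] unfolding g_def by measurable
    have g: "\<bar>g i w\<bar> \<le> C" if "w \<in> space (data_space (- A))" for i w
      using C[OF that, of i] C0 by (simp add: g_def)
    have "comparison_noise k A e = (\<Sum>i\<in>A. e $ i * g i (train A e))" for e
      by (simp add: comparison_noise_def g_def grid_max_def fit_def)
    then show ?thesis
      using expectation_noise_times_train[of _ A "g _" C] g by (simp add: Bochner_Integration.integral_sum)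
  qed
  show "expectation (\<lambda>\<omega>. comparison_noise k (J \<omega>) (\<epsilon> \<omega>)) = 0"
    using indep_pair_expectation_0[OF indep_split split_pair_measurable, of "comparison_noise k"] int fixed
    by simp
qed

lemma nn_integral_split_Max_noise_le:
  assumes "\<And>A j. (\<Sum>i\<in>A. (X $ i $ j)\<^sup>2) \<le> v"
  shows "(\<integral>\<^sup>+\<omega>. ennreal (Max (range (\<lambda>j. \<bar>\<Sum>i\<in>J \<omega>. \<epsilon> \<omega> $ i * X $ i $ j\<bar>))) \<partial>P)
    \<le> ennreal (sqrt (2 * (\<sigma>\<^sup>2 * v) * ln (2 * real CARD('p))))"
  by (rule split_nn_integral_le[of "\<lambda>A e. ennreal (Max (range (\<lambda>j. \<bar>\<Sum>i\<in>A. e $ i * X $ i $ j\<bar>)))"])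
    (measurable, rule nn_integral_Max_noise_le[OF assms])

text \<open>Each index is tested with probability 1/2 independently of its noise, so half of the
  full second moment remains. This half enters the factor \<open>3 / 2\<close> of the final
  comparison of constants.\<close>

lemma nn_integral_test_response_le:
  assumes half: "\<And>i. prob {\<omega> \<in> space P. i \<in> J \<omega>} = 1 / 2"
  shows "(\<integral>\<^sup>+\<omega>. ennreal ((L2_set (\<lambda>i. m $ i + \<epsilon> \<omega> $ i) (J \<omega>))\<^sup>2) \<partial>P)
    \<le> ennreal (((norm m)\<^sup>2 + real CARD('n) * \<sigma>\<^sup>2) / 2)"
proof -
  define h where "h i \<omega> = (if i \<in> J \<omega> then 1 else 0 :: real)" for i \<omega>
  have [measurable]: "h i \<in> borel_measurable P" for i unfolding h_def by measurable
  have h: "integrable P (h i)" "expectation (h i) = 1 / 2" for i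
  proof -
    have "h i = indicator {\<omega>. i \<in> J \<omega>}" by (auto simp: h_def indicator_def)
    then show "expectation (h i) = 1 / 2"
      using half[of i] by (simp add: Collect_conj_eq Int_commute)
    show "integrable P (h i)" by (rule integrable_const_bound[of _ 1]) (auto simp: h_def)
  qed
  have y: "integrable P (\<lambda>\<omega>. (m $ i + \<epsilon> \<omega> $ i)\<^sup>2)"
      "expectation (\<lambda>\<omega>. (m $ i + \<epsilon> \<omega> $ i)\<^sup>2) = (m $ i)\<^sup>2 + \<sigma>\<^sup>2" for i
    unfolding power2_sum using noise_second_moment[of i] noise_mean[of i] by (auto simp: prob_space)
  let ?c = "\<lambda>i. (m $ i)\<^sup>2 + \<sigma>\<^sup>2"
  have "(\<integral>\<^sup>+\<omega>. ennreal ((L2_set (\<lambda>i. m $ i + \<epsilon> \<omega> $ i) (J \<omega>))\<^sup>2) \<partial>P)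
      \<le> (\<integral>\<^sup>+\<omega>. ennreal (\<Sum>i\<in>J \<omega>. ?c i) \<partial>P)"
  proof (rule split_nn_integral_mono[of "\<lambda>A e. ennreal ((L2_set (\<lambda>i. m $ i + e $ i) A)\<^sup>2)" "\<lambda>A e. ennreal (\<Sum>i\<in>A. ?c i)"])
    fix A
    show "(\<lambda>e. ennreal ((L2_set (\<lambda>i. m $ i + e $ i) A)\<^sup>2)) \<in> borel_measurable borel"
      unfolding L2_set_def by measurable
    have "(\<integral>\<^sup>+\<omega>. ennreal (\<Sum>i\<in>A. (m $ i + \<epsilon> \<omega> $ i)\<^sup>2) \<partial>P) = ennreal (expectation (\<lambda>\<omega>. \<Sum>i\<in>A. (m $ i + \<epsilon> \<omega> $ i)\<^sup>2))"
      using y(1) by (intro nn_integral_eq_integral Bochner_Integration.integrable_sum AE_I2) (auto intro: sum_nonneg)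
    also have "expectation (\<lambda>\<omega>. \<Sum>i\<in>A. (m $ i + \<epsilon> \<omega> $ i)\<^sup>2) = (\<Sum>i\<in>A. ?c i)"
      using y by (simp add: Bochner_Integration.integral_sum)
    finally show "(\<integral>\<^sup>+\<omega>. ennreal ((L2_set (\<lambda>i. m $ i + \<epsilon> \<omega> $ i) A)\<^sup>2) \<partial>P) \<le> (\<integral>\<^sup>+\<omega>. ennreal (\<Sum>i\<in>A. ?c i) \<partial>P)"
      by (simp add: L2_set_def sum_nonneg emeasure_space_1)
  qed simp
  also have "\<dots> = (\<integral>\<^sup>+\<omega>. ennreal (\<Sum>i\<in>UNIV. h i \<omega> * ?c i) \<partial>P)"
    by (intro nn_integral_cong arg_cong[where f=ennreal] sum.mono_neutral_cong_left) (auto simp: h_def)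
  also have "\<dots> = ennreal (expectation (\<lambda>\<omega>. \<Sum>i\<in>UNIV. h i \<omega> * ?c i))"
  proof (rule nn_integral_eq_integral)
    show "integrable P (\<lambda>\<omega>. \<Sum>i\<in>UNIV. h i \<omega> * ?c i)"
      using h(1) by (intro Bochner_Integration.integrable_sum integrable_mult_left)
  qed (auto simp: h_def intro!: sum_nonneg)
  also have "expectation (\<lambda>\<omega>. \<Sum>i\<in>UNIV. h i \<omega> * ?c i) = (\<Sum>i\<in>UNIV. ?c i / 2)"
    using h(1) by (simp add: Bochner_Integration.integral_sum h(2))
  also have "\<dots> = ((norm m)\<^sup>2 + real CARD('n) * \<sigma>\<^sup>2) / 2"
    by (simp add: norm_sq_vec sum.distrib sum_divide_distrib[symmetric])
  finally show ?thesis .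
qed

end

section \<open>The random split and the variance estimate\<close>

text \<open>The largest absolute entry of the difference between the Gram matrices of the rows in
  \<open>A\<close> and of the rows in \<open>- A\<close>.\<close>

definition split_imbalance :: "real^'p^'n \<Rightarrow> 'n set \<Rightarrow> real" where
  "split_imbalance X A = Max (range (\<lambda>(j, k). \<bar>\<Sum>i\<in>UNIV. (if i \<in> A then 1 else - 1) * (X $ i $ j * X $ i $ k)\<bar>))"

lemma split_imbalance_Compl: "split_imbalance X (- A) = split_imbalance X A"
proof -
  have "(\<Sum>i\<in>UNIV. (if i \<in> - A then 1 else - 1) * (X $ i $ j * X $ i $ k))
      = - (\<Sum>i\<in>UNIV. (if i \<in> A then 1 else - 1) * (X $ i $ j * X $ i $ k))" for j k
    unfolding sum_negf[symmetric] by (intro sum.cong) auto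
  then show ?thesis by (simp add: split_imbalance_def)
qed

lemma split_imbalance_nonneg: "0 \<le> split_imbalance X A"
  unfolding split_imbalance_def by (rule order_trans[OF _ Max_ge[OF _ rangeI]]) (auto simp: case_prod_beta)

text \<open>Hoeffding's lemma for each sign on an interval of length
  \<open>2 * \<bar>t * c i\<bar>\<close>; as \<open>2\<^sup>2 / 8 = 1 / 2\<close>, the exponent has
  the Gaussian form, and one maximal inequality serves both signs and noise.\<close>

lemma (in prob_space) coin_flip_mgf:
  fixes I :: "'a \<Rightarrow> 'n::finite set" and c :: "'n \<Rightarrow> real"
  assumes I: "indep_vars (\<lambda>_. count_space UNIV) (\<lambda>i \<omega>. i \<in> I \<omega>) UNIV"
    and half: "\<And>i. prob {\<omega> \<in> space M. i \<in> I \<omega>} = 1 / 2"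
  shows "(\<integral>\<^sup>+\<omega>. ennreal (exp (t * (\<Sum>i\<in>UNIV. (if i \<in> I \<omega> then 1 else - 1) * c i))) \<partial>M)
    \<le> ennreal (exp (t\<^sup>2 * (\<Sum>i\<in>UNIV. (c i)\<^sup>2) / 2))"
proof -
  define s where "s i \<omega> = (if i \<in> I \<omega> then 1 else - 1 :: real)" for i \<omega>
  have ind: "indep_vars (\<lambda>_. borel) (\<lambda>i \<omega>. ennreal (exp (t * c i * s i \<omega>))) UNIV"
    unfolding s_def
    by (rule indep_vars_compose2[OF I, of "\<lambda>i b. ennreal (exp (t * c i * (if b then 1 else - 1)))"]) auto
  have [measurable]: "Measurable.pred M (\<lambda>\<omega>. i \<in> I \<omega>)" for i
    using I unfolding indep_vars_def2 by blast
  have [measurable]: "s i \<in> borel_measurable M" for i unfolding s_def by measurable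
  have s0: "expectation (s i) = 0" for i
  proof -
    define S where "S = {\<omega> \<in> space M. i \<in> I \<omega>}"
    have S: "S \<in> events" unfolding S_def by measurable
    then have int: "integrable M (\<lambda>\<omega>. 2 * indicator S \<omega> :: real)"
      by (intro integrable_mult_right integrable_real_indicator) (auto simp: emeasure_eq_measure)
    have half': "expectation (\<lambda>\<omega>. 2 * indicator S \<omega> :: real) = 1" using half[of i] S by (simp add: S_def)
    have "s i \<omega> = 2 * indicator S \<omega> - 1" if "\<omega> \<in> space M" for \<omega>
      using that by (simp add: s_def S_def)
    then have "expectation (s i) = expectation (\<lambda>\<omega>. 2 * indicator S \<omega> - 1)"
      by (intro Bochner_Integration.integral_cong) auto
    also have "\<dots> = 0" using int half' by (simp only: Bochner_Integration.integral_diff integrable_const) (simp add: prob_space)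
    finally show ?thesis .
  qed
  have one: "(\<integral>\<^sup>+\<omega>. ennreal (exp (t * c i * s i \<omega>)) \<partial>M) \<le> ennreal (exp (t\<^sup>2 * (c i)\<^sup>2 / 2))" for i
  proof -
    interpret interval_bounded_random_variable M "\<lambda>\<omega>. t * c i * s i \<omega>" "- \<bar>t * c i\<bar>" "\<bar>t * c i\<bar>"
    proof
      show "(\<lambda>\<omega>. t * c i * s i \<omega>) \<in> borel_measurable M" by measurable
      show "AE \<omega> in M. t * c i * s i \<omega> \<in> {- \<bar>t * c i\<bar>..\<bar>t * c i\<bar>}"
      proof (rule AE_I2)
        fix \<omega>
        show "t * c i * s i \<omega> \<in> {- \<bar>t * c i\<bar>..\<bar>t * c i\<bar>}" 
          using abs_ge_self[of "t * c i"] abs_ge_minus_self[of "t * c i"] by (simp only: s_def split: if_split) simp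
      qed
    qed
    have "(\<integral>\<^sup>+\<omega>. ennreal (exp (1 * (t * c i * s i \<omega>))) \<partial>M)
        \<le> ennreal (exp (1\<^sup>2 * (\<bar>t * c i\<bar> - - \<bar>t * c i\<bar>)\<^sup>2 / 8))"
      by (rule Hoeffdings_lemma_nn_integral_0) (simp_all add: s0)
    then show ?thesis by (simp add: power_mult_distrib)
  qed
  have "(\<integral>\<^sup>+\<omega>. ennreal (exp (t * (\<Sum>i\<in>UNIV. s i \<omega> * c i))) \<partial>M)
      = (\<integral>\<^sup>+\<omega>. (\<Prod>i\<in>UNIV. ennreal (exp (t * c i * s i \<omega>))) \<partial>M)"
    by (simp add: prod_ennreal sum_distrib_left exp_sum mult_ac)
  also have "\<dots> = (\<Prod>i\<in>UNIV. \<integral>\<^sup>+\<omega>. ennreal (exp (t * c i * s i \<omega>)) \<partial>M)"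
    by (rule indep_vars_nn_integral[OF _ ind]) auto
  also have "\<dots> \<le> (\<Prod>i\<in>UNIV. ennreal (exp (t\<^sup>2 * (c i)\<^sup>2 / 2)))"
    by (intro prod_mono_ennreal one)
  also have "\<dots> = ennreal (exp (t\<^sup>2 * (\<Sum>i\<in>UNIV. (c i)\<^sup>2) / 2))"
    by (simp add: prod_ennreal exp_sum[symmetric] sum_distrib_left sum_divide_distrib)
  finally show ?thesis by (simp add: s_def)
qed

lemma (in prob_space) nn_integral_split_imbalance_le:
  fixes I :: "'a \<Rightarrow> 'n::finite set" and X :: "real^'p^'n"
  assumes I: "indep_vars (\<lambda>_. count_space UNIV) (\<lambda>i \<omega>. i \<in> I \<omega>) UNIV"
    and half: "\<And>i. prob {\<omega> \<in> space M. i \<in> I \<omega>} = 1 / 2"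
    and v: "\<And>j k. (\<Sum>i\<in>UNIV. (X $ i $ j * X $ i $ k)\<^sup>2) \<le> v"
  shows "(\<integral>\<^sup>+\<omega>. ennreal (split_imbalance X (I \<omega>)) \<partial>M)
    \<le> ennreal (sqrt (2 * v * ln (2 * (real CARD('p))\<^sup>2)))"
proof -
  define Z where "Z jk \<omega> = (\<Sum>i\<in>UNIV. (if i \<in> I \<omega> then 1 else - 1) * (X $ i $ fst jk * X $ i $ snd jk))" for jk \<omega>
  have [measurable]: "Measurable.pred M (\<lambda>\<omega>. i \<in> I \<omega>)" for i
    using I unfolding indep_vars_def2 by blast
  have v0: "0 \<le> v" using v by (rule order_trans[OF sum_nonneg, rotated]) auto
  have "(\<integral>\<^sup>+\<omega>. ennreal (Max ((\<lambda>jk. \<bar>Z jk \<omega>\<bar>) ` UNIV)) \<partial>M)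
      \<le> ennreal (sqrt (2 * v * ln (2 * real CARD('p \<times> 'p))))"
  proof (rule nn_integral_Max_abs_le)
    fix jk :: "'p \<times> 'p" and t :: real
    show "Z jk \<in> borel_measurable M" unfolding Z_def by measurable
    have "(\<integral>\<^sup>+\<omega>. ennreal (exp (t * Z jk \<omega>)) \<partial>M)
        \<le> ennreal (exp (t\<^sup>2 * (\<Sum>i\<in>UNIV. (X $ i $ fst jk * X $ i $ snd jk)\<^sup>2) / 2))"
      unfolding Z_def by (rule coin_flip_mgf[OF I half])
    also have "\<dots> \<le> ennreal (exp (t\<^sup>2 * v / 2))"
      using v[of "fst jk" "snd jk"] by (intro ennreal_leI) (auto intro!: mult_left_mono)
    finally show "(\<integral>\<^sup>+\<omega>. ennreal (exp (t * Z jk \<omega>)) \<partial>M) \<le> ennreal (exp (t\<^sup>2 * v / 2))" .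
  qed (use v0 in auto)
  then show ?thesis
    by (simp add: split_imbalance_def Z_def case_prod_beta power2_eq_square)
qed

context lasso_fold
begin

lemma fold_prediction_error:
  fixes \<beta>star :: "real^'p"
  assumes m: "m = X *v \<beta>star"
    and min: "is_arg_min (\<lambda>K. \<Sum>i\<in>A. ((m + e) $ i - (X *v b (- A) K (train A e)) $ i)\<^sup>2)
             (\<lambda>K. K \<in> (\<lambda>k. real k * \<delta>) ` {0..grid_max A e}) K"
    and k: "k \<le> grid_max A e" "l1_norm \<beta>star \<le> real k * \<delta>" "real k * \<delta> \<le> L"
  shows "(\<Sum>i\<in>A. ((X *v b (- A) K (train A e)) $ i - m $ i)\<^sup>2)
    \<le> 2 * L * Max (range (\<lambda>j. \<bar>\<Sum>i\<in>- A. e $ i * X $ i $ j\<bar>)) + 4 * L\<^sup>2 * split_imbalance X A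
      + 4 * (L2_set (\<lambda>i. m $ i + e $ i) A * max_aligned A e) - 2 * comparison_noise k A e"
proof -
  obtain h where h: "h \<le> grid_max A e" "K = real h * \<delta>"
    using min by (auto simp: is_arg_min_def)
  have "(\<Sum>i\<in>A. (m $ i + e $ i - fit A e h i)\<^sup>2) \<le> (\<Sum>i\<in>A. (m $ i + e $ i - fit A e l i)\<^sup>2)"
    if "l \<le> grid_max A e" for l
    using min that unfolding is_arg_min_def h(2) by (auto simp: fit_def not_less)
  moreover have "fit A e 0 i = 0" for i
    using l1_norm_le_0D[OF fold_rule_arg_min(2)[OF rule _ train_space, of 0]] by (simp add: fit_def)
  ultimately have sel: "(\<Sum>i\<in>A. (m $ i - fit A e h i)\<^sup>2) \<le> (\<Sum>i\<in>A. (m $ i - fit A e k i)\<^sup>2)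
      + 4 * (L2_set (\<lambda>i. m $ i + e $ i) A * max_aligned A e) - 2 * comparison_noise k A e"
    using fold_selection_error[of A "fit A e" k "grid_max A e" h "\<lambda>i. m $ i" "\<lambda>i. e $ i"] k(1) h(1)
    by (simp add: max_aligned_def comparison_noise_def)
  define \<beta> where "\<beta> = b (- A) (real k * \<delta>) (train A e)"
  define u where "u = \<beta> - \<beta>star"
  have kd: "0 \<le> real k * \<delta>" using \<delta>_pos by simp
  note am = fold_rule_arg_min[OF rule kd train_space[of A e], folded \<beta>_def]
  have u: "l1_norm u \<le> 2 * L"
    using l1_norm_triangle_diff[of \<beta> \<beta>star] am(2) k by (simp add: u_def)
  have L: "0 \<le> L" using kd k(3) by linarith
  \<comment> \<open>Projection is available on \<open>- A\<close>, where \<open>\<beta>\<close>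
    minimizes the loss. The true parameter is feasible because \<open>k\<close> was rounded up, and
    the residual there is pure noise.\<close>
  have "(\<Sum>i\<in>- A. ((X *v u) $ i)\<^sup>2) \<le> (\<Sum>i\<in>- A. (train A e i - (X *v \<beta>star) $ i) * (X *v u) $ i)"
    unfolding u_def by (rule lasso_projection[OF am(1) k(2)])
  also have "\<dots> = (\<Sum>i\<in>- A. e $ i * (X *v u) $ i)"
  proof (intro sum.cong refl)
    fix i assume "i \<in> - A"
    then have "train A e i = m $ i + e $ i" by (simp add: train_def data_on_def)
    then show "(train A e i - (X *v \<beta>star) $ i) * (X *v u) $ i = e $ i * (X *v u) $ i"
      by (simp add: m[symmetric])
  qed
  also have "\<dots> \<le> l1_norm u * Max (range (\<lambda>j. \<bar>\<Sum>i\<in>- A. e $ i * X $ i $ j\<bar>))"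
    using abs_noise_le[where e = "\<lambda>i. e $ i" and A = "- A" and X = X and u = u] by linarith
  also have "\<dots> \<le> 2 * L * Max (range (\<lambda>j. \<bar>\<Sum>i\<in>- A. e $ i * X $ i $ j\<bar>))"
    by (intro mult_right_mono u order_trans[OF _ Max_ge[OF _ rangeI]]) auto
  finally have train: "(\<Sum>i\<in>- A. ((X *v u) $ i)\<^sup>2) \<le> 2 * L * Max (range (\<lambda>j. \<bar>\<Sum>i\<in>- A. e $ i * X $ i $ j\<bar>))" .
  \<comment> \<open>The direction \<open>u\<close> depends on the noise and on the split, so the
    sign form is bounded uniformly over the l1 ball of radius \<open>2 * L\<close>.\<close>
  have "(\<Sum>i\<in>A. ((X *v u) $ i)\<^sup>2) - (\<Sum>i\<in>- A. ((X *v u) $ i)\<^sup>2)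
      = (\<Sum>i\<in>UNIV. (if i \<in> A then 1 else - 1) * ((X *v u) $ i)\<^sup>2)"
    by (simp add: if_distrib[of "\<lambda>x. x * _"] sum.If_cases sum_negf Compl_eq cong: if_cong)
  also have "\<dots> \<le> (l1_norm u)\<^sup>2 * split_imbalance X A"
    unfolding split_imbalance_def by (rule quadratic_form_le)
  also have "\<dots> \<le> (2 * L)\<^sup>2 * split_imbalance X A"
    using u l1_norm_nonneg[of u] by (intro mult_right_mono power_mono split_imbalance_nonneg)
  finally have "(\<Sum>i\<in>A. ((X *v u) $ i)\<^sup>2) \<le> (\<Sum>i\<in>- A. ((X *v u) $ i)\<^sup>2) + 4 * L\<^sup>2 * split_imbalance X A"
    by (simp add: power_mult_distrib)
  moreover have "(\<Sum>i\<in>A. (m $ i - fit A e k i)\<^sup>2) = (\<Sum>i\<in>A. ((X *v u) $ i)\<^sup>2)"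
  proof (rule sum.cong[OF refl])
    fix i
    show "(m $ i - fit A e k i)\<^sup>2 = ((X *v u) $ i)\<^sup>2"
      unfolding fit_def \<beta>_def[symmetric] u_def matrix_vector_mult_diff_distrib
      by (simp add: m[symmetric] power2_commute)
  qed
  moreover have "(\<Sum>i\<in>A. ((X *v b (- A) K (train A e)) $ i - m $ i)\<^sup>2) = (\<Sum>i\<in>A. (m $ i - fit A e h i)\<^sup>2)"
    by (simp add: fit_def h(2) power2_commute)
  ultimately show ?thesis using sel train by linarith
qed

lemma max_aligned_nonneg: "0 \<le> max_aligned A e"
proof -
  have "0 \<le> aligned_noise A (\<lambda>i. e $ i) (fit A e 0)" by (simp add: aligned_noise_def)
  also have "\<dots> \<le> max_aligned A e" unfolding max_aligned_def by (intro Max_ge) auto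
  finally show ?thesis .
qed

text \<open>The response and the maximum involve the same noise, so Cauchy-Schwarz is used instead
  of independence. This is the origin of the square roots of the logarithmic means.\<close>

lemma nn_integral_response_aligned_le:
  assumes half: "\<And>i. prob {\<omega> \<in> space P. i \<in> J \<omega>} = 1 / 2"
    and r: "(\<integral>\<^sup>+\<omega>. ennreal (ln (real (grid_max (J \<omega>) (\<epsilon> \<omega>)) + 1)) \<partial>P) = ennreal r" "0 \<le> r"
  shows "(\<integral>\<^sup>+\<omega>. ennreal (L2_set (\<lambda>i. m $ i + \<epsilon> \<omega> $ i) (J \<omega>) * max_aligned (J \<omega>) (\<epsilon> \<omega>)) \<partial>P)
    \<le> ennreal (sqrt (((norm m)\<^sup>2 + real CARD('n) * \<sigma>\<^sup>2) / 2 * (3 * \<sigma>\<^sup>2 * r)))"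
proof (rule nn_integral_mult_le_sqrt)
  show "(\<lambda>\<omega>. L2_set (\<lambda>i. m $ i + \<epsilon> \<omega> $ i) (J \<omega>)) \<in> borel_measurable P"
    by (rule split_measurable[of "\<lambda>A e. L2_set (\<lambda>i. m $ i + e $ i) A"]) (simp add: L2_set_def)
  show "(\<lambda>\<omega>. max_aligned (J \<omega>) (\<epsilon> \<omega>)) \<in> borel_measurable P"
    by (rule split_measurable) measurable
  have "(\<lambda>\<omega>. grid_max (J \<omega>) (\<epsilon> \<omega>)) \<in> measurable P (count_space UNIV)"
    by (rule split_measurable) measurable
  note [measurable] = this
  have "(\<integral>\<^sup>+\<omega>. ennreal ((max_aligned (J \<omega>) (\<epsilon> \<omega>))\<^sup>2) \<partial>P)
    \<le> (\<integral>\<^sup>+\<omega>. ennreal (3 * \<sigma>\<^sup>2) * ennreal (ln (real (grid_max (J \<omega>) (\<epsilon> \<omega>)) + 1)) \<partial>P)"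
    using nn_integral_max_aligned_le by (simp add: ennreal_mult)
  also have "\<dots> = ennreal (3 * \<sigma>\<^sup>2 * r)"
    using r by (subst nn_integral_cmult) (auto simp: ennreal_mult)
  finally show "(\<integral>\<^sup>+\<omega>. ennreal ((max_aligned (J \<omega>) (\<epsilon> \<omega>))\<^sup>2) \<partial>P) \<le> ennreal (3 * \<sigma>\<^sup>2 * r)" .
qed (use nn_integral_test_response_le[OF half] r in \<open>auto simp: max_aligned_nonneg\<close>)

end

text \<open>\<open>d\<close> and \<open>G\<close> enter only through the majorant \<open>U\<close>,
  which is measurable and nonnegative also off \<open>G\<close>. The cross term is a Cauchy-Schwarz
  bound: \<open>2 / n\<close> times the root of \<open>n * \<sigma>\<^sup>2 * (n * r)\<close> is
  \<open>2 * \<sigma> * sqrt r\<close>.\<close>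

lemma (in gaussian_noise) nn_integral_variance_estimate_le:
  fixes d :: "'a \<Rightarrow> real^'n" and U :: "'a \<Rightarrow> real"
  defines "n \<equiv> real CARD('n)"
  assumes U[measurable]: "U \<in> borel_measurable P" and U0: "\<And>\<omega>. \<omega> \<in> space P \<Longrightarrow> 0 \<le> U \<omega>"
    and EU: "(\<integral>\<^sup>+\<omega>. ennreal (U \<omega>) \<partial>P) \<le> ennreal (n * r)" and r: "0 \<le> r"
    and d: "\<And>\<omega>. \<omega> \<in> space P \<Longrightarrow> \<omega> \<in> G \<Longrightarrow> (norm (d \<omega>))\<^sup>2 \<le> U \<omega>"
  shows "(\<integral>\<^sup>+\<omega>. ennreal \<bar>(norm (\<epsilon> \<omega> - d \<omega>))\<^sup>2 / n - \<sigma>\<^sup>2\<bar> * indicator G \<omega> \<partial>P)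
    \<le> ennreal (\<sigma>\<^sup>2 * sqrt (2 / n)) + ennreal (2 * \<sigma> * sqrt r) + ennreal r"
proof -
  have n: "n > 0" by (simp add: n_def)
  define V where "V \<omega> = \<bar>(norm (\<epsilon> \<omega>))\<^sup>2 / n - \<sigma>\<^sup>2\<bar>" for \<omega>
  \<comment> \<open>The truncation makes \<open>q\<close> nonnegative everywhere; the sign of
    \<open>U\<close> is known on the space of \<open>P\<close> only.\<close>
  define q where "q \<omega> = sqrt (max 0 (U \<omega>))" for \<omega>
  have [measurable]: "V \<in> borel_measurable P" "q \<in> borel_measurable P"
    unfolding V_def q_def by measurable
  have q2: "(q \<omega>)\<^sup>2 = U \<omega>" if "\<omega> \<in> space P" for \<omega> using U0[OF that] by (simp add: q_def)
  have q0: "0 \<le> q \<omega>" for \<omega> by (simp add: q_def)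
  have point: "ennreal \<bar>(norm (\<epsilon> \<omega> - d \<omega>))\<^sup>2 / n - \<sigma>\<^sup>2\<bar> * indicator G \<omega>
      \<le> ennreal (V \<omega>) + (ennreal (2 / n) * ennreal (norm (\<epsilon> \<omega>) * q \<omega>) + ennreal (1 / n) * ennreal (U \<omega>))"
    if \<omega>: "\<omega> \<in> space P" for \<omega>
  proof (cases "\<omega> \<in> G")
    case True
    let ?e = "norm (\<epsilon> \<omega>)" and ?d = "norm (d \<omega>)" and ?x = "norm (\<epsilon> \<omega> - d \<omega>)"
    have dq: "?d\<^sup>2 \<le> (q \<omega>)\<^sup>2" using d[OF \<omega> True] q2[OF \<omega>] by simp
    then have dq1: "?d \<le> q \<omega>" using q0 by (rule power2_le_imp_le)
    have "\<bar>?x - ?e\<bar> \<le> ?d" using norm_triangle_ineq3[of "\<epsilon> \<omega> - d \<omega>" "\<epsilon> \<omega>"] by simp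
    moreover have "?x + ?e \<le> 2 * ?e + ?d" using norm_triangle_ineq4[of "\<epsilon> \<omega>" "d \<omega>"] by simp
    ultimately have "\<bar>?x - ?e\<bar> * (?x + ?e) \<le> ?d * (2 * ?e + ?d)" by (intro mult_mono) auto
    moreover have "\<bar>?x\<^sup>2 - ?e\<^sup>2\<bar> = \<bar>?x - ?e\<bar> * (?x + ?e)"
    proof -
      have "?x\<^sup>2 - ?e\<^sup>2 = (?x - ?e) * (?x + ?e)" 
        by (simp only: power2_eq_square square_diff_square_factored mult.commute)
      then show ?thesis by (simp only: abs_mult abs_of_nonneg[OF add_nonneg_nonneg[OF norm_ge_zero norm_ge_zero]])
    qed
    moreover have "?d * (2 * ?e + ?d) = 2 * (?e * ?d) + ?d\<^sup>2"
      by (simp only: power2_eq_square distrib_left mult.left_commute mult.commute)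
    ultimately have "\<bar>?x\<^sup>2 - ?e\<^sup>2\<bar> \<le> 2 * (?e * ?d) + ?d\<^sup>2" by (simp only:)
    also have "\<dots> \<le> 2 * (?e * q \<omega>) + U \<omega>"
      using d[OF \<omega> True] dq1 by (intro add_mono mult_left_mono) auto
    finally have "\<bar>?x\<^sup>2 - ?e\<^sup>2\<bar> / n \<le> (2 * (?e * q \<omega>) + U \<omega>) / n"
      using n by (intro divide_right_mono) auto
    moreover have "\<bar>?x\<^sup>2 / n - \<sigma>\<^sup>2\<bar> \<le> V \<omega> + \<bar>?x\<^sup>2 - ?e\<^sup>2\<bar> / n"
    proof -
      have "?x\<^sup>2 / n - \<sigma>\<^sup>2 = (?e\<^sup>2 / n - \<sigma>\<^sup>2) + (?x\<^sup>2 - ?e\<^sup>2) / n" by (simp add: diff_divide_distrib)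
      then show ?thesis
        using abs_triangle_ineq[of "?e\<^sup>2 / n - \<sigma>\<^sup>2" "(?x\<^sup>2 - ?e\<^sup>2) / n"] n by (simp add: V_def)
    qed
    ultimately have "\<bar>?x\<^sup>2 / n - \<sigma>\<^sup>2\<bar> \<le> V \<omega> + (2 / n * (?e * q \<omega>) + 1 / n * U \<omega>)"
      by (simp add: add_divide_distrib)
    then have "ennreal \<bar>?x\<^sup>2 / n - \<sigma>\<^sup>2\<bar> \<le> ennreal (V \<omega> + (2 / n * (?e * q \<omega>) + 1 / n * U \<omega>))"
      by (rule ennreal_leI)
    also have "\<dots> = ennreal (V \<omega>) + (ennreal (2 / n) * ennreal (?e * q \<omega>) + ennreal (1 / n) * ennreal (U \<omega>))"
      using n q0 U0[OF \<omega>] by (simp add: V_def ennreal_mult[symmetric])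
    finally show ?thesis using True by simp
  qed simp
  have "(\<integral>\<^sup>+\<omega>. ennreal \<bar>(norm (\<epsilon> \<omega> - d \<omega>))\<^sup>2 / n - \<sigma>\<^sup>2\<bar> * indicator G \<omega> \<partial>P)
      \<le> (\<integral>\<^sup>+\<omega>. ennreal (V \<omega>) + (ennreal (2 / n) * ennreal (norm (\<epsilon> \<omega>) * q \<omega>) + ennreal (1 / n) * ennreal (U \<omega>)) \<partial>P)"
    by (rule nn_integral_mono) (rule point)
  also have "\<dots> = (\<integral>\<^sup>+\<omega>. ennreal (V \<omega>) \<partial>P) + (ennreal (2 / n) * (\<integral>\<^sup>+\<omega>. ennreal (norm (\<epsilon> \<omega>) * q \<omega>) \<partial>P)
      + ennreal (1 / n) * (\<integral>\<^sup>+\<omega>. ennreal (U \<omega>) \<partial>P))"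
    by (simp add: nn_integral_add nn_integral_cmult)
  also have "\<dots> \<le> ennreal (\<sigma>\<^sup>2 * sqrt (2 / n)) + (ennreal (2 / n) * ennreal (sqrt (n * \<sigma>\<^sup>2 * (n * r)))
      + ennreal (1 / n) * ennreal (n * r))"
  proof (intro add_mono mult_left_mono EU)
    show "(\<integral>\<^sup>+\<omega>. ennreal (V \<omega>) \<partial>P) \<le> ennreal (\<sigma>\<^sup>2 * sqrt (2 / n))"
      using nn_integral_noise_variance_error by (simp add: V_def n_def)
    have "(\<integral>\<^sup>+\<omega>. ennreal ((q \<omega>)\<^sup>2) \<partial>P) = (\<integral>\<^sup>+\<omega>. ennreal (U \<omega>) \<partial>P)"
      by (intro nn_integral_cong) (simp add: q2)
    then show "(\<integral>\<^sup>+\<omega>. ennreal (norm (\<epsilon> \<omega>) * q \<omega>) \<partial>P) \<le> ennreal (sqrt (n * \<sigma>\<^sup>2 * (n * r)))"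
      using EU nn_integral_norm_noise_sq n r q0 by (intro nn_integral_mult_le_sqrt) (auto simp: n_def)
  qed auto
  also have "sqrt (n * \<sigma>\<^sup>2 * (n * r)) = n * \<sigma> * sqrt r"
    using n \<sigma>_pos by (simp add: real_sqrt_mult mult_ac)
  also have "ennreal (2 / n) * ennreal (n * \<sigma> * sqrt r) = ennreal (2 * \<sigma> * sqrt r)"
    using n \<sigma>_pos r by (simp add: ennreal_mult[symmetric])
  also have "ennreal (1 / n) * ennreal (n * r) = ennreal r"
    using n r by (simp add: ennreal_mult[symmetric])
  finally show ?thesis by (simp add: add.assoc)
qed

section \<open>The cross-validated Lasso\<close>

lemma ennreal_sqrt_mono: "x \<le> y \<Longrightarrow> ennreal_sqrt x \<le> ennreal_sqrt y"
  by (cases x; cases y) (auto simp: ennreal_sqrt_def ennreal_leI top_unique)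

context prob_space
begin

text \<open>Bundles the side conditions under which means of sums are bounded termwise, so that two
  closure rules bound \<open>W\<close> along its syntactic shape.\<close>

definition mean_le :: "('a \<Rightarrow> real) \<Rightarrow> real \<Rightarrow> bool" where
  "mean_le f a \<longleftrightarrow> f \<in> borel_measurable M \<and> (\<forall>x. 0 \<le> f x) \<and> 0 \<le> a \<and> (\<integral>\<^sup>+x. ennreal (f x) \<partial>M) \<le> ennreal a"

lemma mean_le_add: "mean_le f a \<Longrightarrow> mean_le g b \<Longrightarrow> mean_le (\<lambda>x. f x + g x) (a + b)"
  by (auto simp: mean_le_def nn_integral_add add_mono)

lemma mean_le_mult:
  assumes "0 \<le> c" "mean_le f a"
  shows "mean_le (\<lambda>x. c * f x) (c * a)"
proof -
  have "(\<integral>\<^sup>+x. ennreal (c * f x) \<partial>M) = ennreal c * (\<integral>\<^sup>+x. ennreal (f x) \<partial>M)"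
    using assms by (subst nn_integral_cmult[symmetric]) (auto simp: mean_le_def ennreal_mult)
  also have "\<dots> \<le> ennreal c * ennreal a" using assms by (intro mult_left_mono) (auto simp: mean_le_def)
  finally show ?thesis using assms by (auto simp: mean_le_def ennreal_mult)
qed

end

section \<open>Numerical constants\<close>

text \<open>
  The margin is uniform: \<open>(128 / 7)\<^sup>2 * 3 / 2 \<le> 512\<close>, \<open>512 / 7 \<le> 96\<close> and
  \<open>(128 / 7 + 16) * sqrt 2 \<le> 57\<close>.
\<close>

lemma risk_constants:
  fixes L w \<sigma> n lg ld r1 r2 mm :: real
  assumes pos: "0 \<le> L" "0 \<le> w" "0 < \<sigma>" "0 < n" "0 \<le> lg" "0 \<le> r1" "0 \<le> r2"
    and mm: "mm \<le> L\<^sup>2 * (n * w\<^sup>2)" and ld: "ld \<le> 2 * lg"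
  defines "q \<equiv> sqrt (2 * (\<sigma>\<^sup>2 * (n * w\<^sup>2)) * lg)" and "d \<equiv> sqrt (2 * (n * w ^ 4) * ld)"
    and "t1 \<equiv> sqrt ((mm + n * \<sigma>\<^sup>2) / 2 * (3 * \<sigma>\<^sup>2 * r1))" and "t2 \<equiv> sqrt ((mm + n * \<sigma>\<^sup>2) / 2 * (3 * \<sigma>\<^sup>2 * r2))"
    and "c1 \<equiv> 16 * sqrt (4 * \<sigma> ^ 4 + 2 * L\<^sup>2 * w\<^sup>2 * \<sigma>\<^sup>2)" and "c2 \<equiv> 96 * L\<^sup>2 * w\<^sup>2 + 57 * L * w * \<sigma>"
  shows "32 / 7 * ((2 * L * q + 4 * L\<^sup>2 * d + 4 * t1) + (2 * L * q + 4 * L\<^sup>2 * d + 4 * t2)) + 16 * L * q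
    \<le> n * (c1 / sqrt n * (sqrt r1 + sqrt r2) + c2 * sqrt (lg / n))"
proof -
  let ?s = "sqrt n" and ?g = "sqrt lg"
  have s: "?s * ?s = n" using pos by simp
  have "q = sqrt ((\<sigma> * w)\<^sup>2 * (2 * (n * lg)))" by (simp add: q_def power_mult_distrib mult_ac)
  also have "\<dots> = \<sigma> * w * sqrt 2 * (?s * ?g)" using pos by (simp add: real_sqrt_mult)
  finally have q: "q = \<sigma> * w * sqrt 2 * (?s * ?g)" .
  have "d \<le> sqrt ((2 * w\<^sup>2)\<^sup>2 * (n * lg))"
    unfolding d_def
  proof (rule real_sqrt_le_mono)
    have "2 * (n * w ^ 4) * ld \<le> 2 * (n * w ^ 4) * (2 * lg)" using pos ld by (intro mult_left_mono) auto
    then show "2 * (n * w ^ 4) * ld \<le> (2 * w\<^sup>2)\<^sup>2 * (n * lg)"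
      by (simp add: power_mult_distrib mult_ac)
  qed
  also have "\<dots> = 2 * w\<^sup>2 * (?s * ?g)" using pos by (simp only: real_sqrt_mult real_sqrt_abs) simp
  finally have d: "d \<le> 2 * w\<^sup>2 * (?s * ?g)" .
  \<comment> \<open>\<open>128 / 7\<close> is the factor 4 of the selection error times the
    \<open>32 / 7\<close> of the refit.\<close>
  have t: "128 / 7 * sqrt ((mm + n * \<sigma>\<^sup>2) / 2 * (3 * \<sigma>\<^sup>2 * r)) \<le> c1 * (?s * sqrt r)" if r: "0 \<le> r" for r
  proof -
    have "128 / 7 * sqrt ((mm + n * \<sigma>\<^sup>2) / 2 * (3 * \<sigma>\<^sup>2 * r)) = sqrt ((128 / 7)\<^sup>2 * ((mm + n * \<sigma>\<^sup>2) / 2 * (3 * \<sigma>\<^sup>2 * r)))"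
      by (subst real_sqrt_mult) simp
    also have "\<dots> \<le> sqrt (16\<^sup>2 * (4 * \<sigma> ^ 4 + 2 * L\<^sup>2 * w\<^sup>2 * \<sigma>\<^sup>2) * (n * r))"
    proof (rule real_sqrt_le_mono)
      have "(128 / 7)\<^sup>2 * ((mm + n * \<sigma>\<^sup>2) / 2 * (3 * \<sigma>\<^sup>2 * r)) = 24576 / 49 * (\<sigma>\<^sup>2 * r) * (mm + n * \<sigma>\<^sup>2)"
        by (simp add: power2_eq_square)
      also have "\<dots> \<le> 24576 / 49 * (\<sigma>\<^sup>2 * r) * (L\<^sup>2 * (n * w\<^sup>2) + n * \<sigma>\<^sup>2)"
        using r mm by (intro mult_left_mono) auto
      also have "\<dots> = 24576 / 49 * (n * r * L\<^sup>2 * w\<^sup>2 * \<sigma>\<^sup>2) + 24576 / 49 * (n * r * \<sigma> ^ 4)"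
        by (simp add: power2_eq_square power4_eq_xxxx algebra_simps)
      also have "\<dots> \<le> 512 * (n * r * L\<^sup>2 * w\<^sup>2 * \<sigma>\<^sup>2) + 1024 * (n * r * \<sigma> ^ 4)"
        using r pos by (intro add_mono mult_right_mono) auto
      also have "\<dots> = 16\<^sup>2 * (4 * \<sigma> ^ 4 + 2 * L\<^sup>2 * w\<^sup>2 * \<sigma>\<^sup>2) * (n * r)"
        by (simp add: algebra_simps)
      finally show "(128 / 7)\<^sup>2 * ((mm + n * \<sigma>\<^sup>2) / 2 * (3 * \<sigma>\<^sup>2 * r))
          \<le> 16\<^sup>2 * (4 * \<sigma> ^ 4 + 2 * L\<^sup>2 * w\<^sup>2 * \<sigma>\<^sup>2) * (n * r)" .
    qed
    also have "\<dots> = c1 * (?s * sqrt r)"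
    proof -
      have "sqrt (16\<^sup>2 * K * (n * r)) = 16 * sqrt K * (?s * sqrt r)" for K :: real
        by (simp add: real_sqrt_mult)
      then show ?thesis unfolding c1_def .
    qed
    finally show ?thesis .
  qed
  have "sqrt 2 \<le> sqrt ((3 / 2)\<^sup>2)" by (intro real_sqrt_le_mono) (simp add: power2_eq_square)
  then have sq2: "sqrt 2 \<le> 3 / 2" by simp
  \<comment> \<open>\<open>240 / 7\<close> collects \<open>2 * 2 * (32 / 7)\<close> from the
    training noise of the two folds and 16 from the fit on all data. With \<open>3 / 2\<close> for
    the root of 2, the result \<open>360 / 7\<close> is below 57.\<close>
  have "240 / 7 * L * q = 240 / 7 * sqrt 2 * (L * \<sigma> * w * (?s * ?g))" by (simp add: q)
  also have "\<dots> \<le> 57 * (L * \<sigma> * w * (?s * ?g))"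
    using sq2 pos by (intro mult_right_mono) auto
  finally have 1: "240 / 7 * L * q \<le> 57 * (L * \<sigma> * w * (?s * ?g))" .
  have "256 / 7 * L\<^sup>2 * d \<le> 256 / 7 * L\<^sup>2 * (2 * w\<^sup>2 * (?s * ?g))"
    using d by (intro mult_left_mono) auto
  also have "\<dots> = 512 / 7 * (L\<^sup>2 * w\<^sup>2 * (?s * ?g))" by simp
  also have "\<dots> \<le> 96 * (L\<^sup>2 * w\<^sup>2 * (?s * ?g))"
    using pos by (intro mult_right_mono) auto
  finally have 2: "256 / 7 * L\<^sup>2 * d \<le> 96 * (L\<^sup>2 * w\<^sup>2 * (?s * ?g))" .
  have "n * (c1 / ?s * (sqrt r1 + sqrt r2) + c2 * sqrt (lg / n))
      = c1 * (?s * sqrt r1) + c1 * (?s * sqrt r2) + c2 * (?s * ?g)"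
  proof -
    have "n * (c1 / ?s * (sqrt r1 + sqrt r2) + c2 * (?g / ?s))
        = n / ?s * (c1 * (sqrt r1 + sqrt r2) + c2 * ?g)"
      by (simp add: add_divide_distrib distrib_left)
    also have "n / ?s = ?s" using pos by (simp add: real_div_sqrt)
    finally show ?thesis by (simp add: real_sqrt_divide algebra_simps)
  qed
  moreover have "c2 * (?s * ?g) = 96 * (L\<^sup>2 * w\<^sup>2 * (?s * ?g)) + 57 * (L * \<sigma> * w * (?s * ?g))"
    by (simp add: c2_def algebra_simps)
  moreover have "32 / 7 * ((2 * L * q + 4 * L\<^sup>2 * d + 4 * t1) + (2 * L * q + 4 * L\<^sup>2 * d + 4 * t2)) + 16 * L * q
      = 128 / 7 * t1 + 128 / 7 * t2 + 256 / 7 * L\<^sup>2 * d + 240 / 7 * L * q"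
    by (simp add: algebra_simps)
  ultimately show ?thesis
    using 1 2 t[OF pos(6)] t[OF pos(7)] unfolding t1_def t2_def by linarith
qed

theorem theorem3p1:
  fixes P :: "'a measure"
    and X :: "real^'p^'n" and \<beta>star :: "real^'p" and \<sigma> \<delta> :: real
    and \<epsilon> Y \<mu>' :: "'a \<Rightarrow> real^'n" and I :: "'a \<Rightarrow> 'n set"
    and b1 b2 :: "'n set \<Rightarrow> real \<Rightarrow> ('n \<Rightarrow> real) \<Rightarrow> real^'p"
    and b :: "real \<Rightarrow> real^'n \<Rightarrow> real^'p"
    and \<beta>1 \<beta>2 :: "real \<Rightarrow> 'a \<Rightarrow> real^'p" and \<beta>CV :: "'a \<Rightarrow> real^'p"
    and \<nu>1 \<nu>2 :: "'n set \<Rightarrow> ('n \<Rightarrow> real) \<Rightarrow> nat" and N1 N2 :: "'a \<Rightarrow> nat"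
    and K1 K2 Khat \<sigma>hat2 :: "'a \<Rightarrow> real"
    and n p L M C1 C2 E :: real and l1 l2 R :: ennreal
  defines "n \<equiv> real CARD('n)" and "p \<equiv> real CARD('p)"
  assumes "prob_space P" and "\<sigma> > 0" and "\<delta> > 0"
    \<comment> \<open>linear model with i.i.d. normal errors\<close>
    and "prob_space.indep_vars P (\<lambda>_. borel) (\<lambda>i \<omega>. \<epsilon> \<omega> $ i) UNIV"
    and "\<And>i. distributed P lborel (\<lambda>\<omega>. \<epsilon> \<omega> $ i) (normal_density 0 \<sigma>)"
  defines "Y \<equiv> \<lambda>\<omega>. X *v \<beta>star + \<epsilon> \<omega>"
    \<comment> \<open>random split by fair coins, independent of the errors\<close>
  assumes "prob_space.indep_vars P (\<lambda>_. count_space UNIV) (\<lambda>i \<omega>. i \<in> I \<omega>) UNIV"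
    and "\<And>i. measure P {\<omega> \<in> space P. i \<in> I \<omega>} = 1 / 2"
    and "prob_space.indep_set P
           (sets (vimage_algebra (space P) I (count_space UNIV)))
           (sets (vimage_algebra (space P) \<epsilon> borel))"
    \<comment> \<open>Lasso estimates on the two halves\<close>
    and "\<And>A. fold_lasso_rule X A (b1 A)" and "\<And>A. fold_lasso_rule X A (b2 A)"
  defines "\<beta>1 \<equiv> \<lambda>K \<omega>. b1 (I \<omega>) K (data_on (I \<omega>) (Y \<omega>))"
    and "\<beta>2 \<equiv> \<lambda>K \<omega>. b2 (- I \<omega>) K (data_on (- I \<omega>) (Y \<omega>))"
    \<comment> \<open>data-driven ranges for the cross-validation\<close>
  assumes "\<And>A. \<nu>1 A \<in> measurable (data_space A) (count_space UNIV)"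
    and "\<And>A. \<nu>2 A \<in> measurable (data_space A) (count_space UNIV)"
  defines "N1 \<equiv> \<lambda>\<omega>. \<nu>1 (- I \<omega>) (data_on (- I \<omega>) (Y \<omega>))"
    and "N2 \<equiv> \<lambda>\<omega>. \<nu>2 (I \<omega>) (data_on (I \<omega>) (Y \<omega>))"
    \<comment> \<open>cross-validated bounds\<close>
  assumes "K1 \<in> borel_measurable P" and "K2 \<in> borel_measurable P"
    and "\<And>\<omega>. \<omega> \<in> space P \<Longrightarrow>
           is_arg_min (\<lambda>K. \<Sum>i\<in>I \<omega>. (Y \<omega> $ i - (X *v \<beta>2 K \<omega>) $ i)\<^sup>2)
             (\<lambda>K. K \<in> (\<lambda>k. real k * \<delta>) ` {0..N1 \<omega>}) (K1 \<omega>)"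
    and "\<And>\<omega>. \<omega> \<in> space P \<Longrightarrow>
           is_arg_min (\<lambda>K. \<Sum>i\<in>- I \<omega>. (Y \<omega> $ i - (X *v \<beta>1 K \<omega>) $ i)\<^sup>2)
             (\<lambda>K. K \<in> (\<lambda>k. real k * \<delta>) ` {0..N2 \<omega>}) (K2 \<omega>)"
  defines "\<mu>' \<equiv> \<lambda>\<omega>. \<chi> i. if i \<in> I \<omega> then (X *v \<beta>2 (K1 \<omega>) \<omega>) $ i
                              else (X *v \<beta>1 (K2 \<omega>) \<omega>) $ i"
  assumes "full_lasso_rule X b"
    and "Khat \<in> borel_measurable P"
    and "\<And>\<omega>. \<omega> \<in> space P \<Longrightarrow>
           is_arg_min (\<lambda>K. norm (\<mu>' \<omega> - X *v b K (Y \<omega>))) (\<lambda>K. K \<ge> 0) (Khat \<omega>)"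
  defines "\<beta>CV \<equiv> \<lambda>\<omega>. b (Khat \<omega>) (Y \<omega>)"
    and "\<sigma>hat2 \<equiv> \<lambda>\<omega>. (norm (Y \<omega> - X *v \<beta>CV \<omega>))\<^sup>2 / n"
    \<comment> \<open>constants of the bound\<close>
    and "L \<equiv> l1_norm \<beta>star + \<delta>"
    and "M \<equiv> Max (range (\<lambda>j. (1 / n) * (\<Sum>i\<in>UNIV. (X $ i $ j) ^ 4)))"
    and "l1 \<equiv> \<integral>\<^sup>+ \<omega>. ennreal (ln (real (N1 \<omega>) + 1)) \<partial>P"
    and "l2 \<equiv> \<integral>\<^sup>+ \<omega>. ennreal (ln (real (N2 \<omega>) + 1)) \<partial>P"
    and "C1 \<equiv> 16 * sqrt (4 * \<sigma> ^ 4 + 2 * L\<^sup>2 * M powr (1/2) * \<sigma>\<^sup>2)"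
    and "C2 \<equiv> 96 * L\<^sup>2 * M powr (1/2) + 57 * L * M powr (1/4) * \<sigma>"
    and "E \<equiv> 16 * sqrt ((n + 5) * \<sigma> ^ 4 / n + (n + 1) * \<sigma>\<^sup>2 / n * L\<^sup>2 * M powr (1/2))
               * ((1 + 2 powr (-1/2)) / 2) powr (n / 2)"
    and "R \<equiv> ennreal (C1 / sqrt n) * (ennreal_sqrt l1 + ennreal_sqrt l2)
               + ennreal (C2 * sqrt (ln (2 * p) / n)) + ennreal E"
  shows "(\<integral>\<^sup>+ \<omega>. ennreal \<bar>\<sigma>hat2 \<omega> - \<sigma>\<^sup>2\<bar>
            * indicator {\<omega>. real (N1 \<omega>) * \<delta> \<ge> l1_norm \<beta>star \<and> real (N2 \<omega>) * \<delta> \<ge> l1_norm \<beta>star} \<omega> \<partial>P)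
         \<le> ennreal (\<sigma>\<^sup>2 * sqrt (2 / n)) + ennreal (2 * \<sigma>) * ennreal_sqrt R + R"
proof -

  \<comment> \<open>The two folds as instances of one situation\<close>
  interpret prob_space P by fact
  interpret gaussian_noise P \<epsilon> \<sigma> by unfold_locales fact+
  define m where "m = X *v \<beta>star"
  have I_sets: "I -` A \<inter> space P \<in> sets (vimage_algebra (space P) I (count_space UNIV))" for A
    by (rule in_vimage_algebra) simp
  have \<epsilon>_sets: "\<epsilon> -` B \<inter> space P \<in> sets (vimage_algebra (space P) \<epsilon> borel)" if "B \<in> sets borel" for B
    using that by (rule in_vimage_algebra)
  have I_measurable [measurable]: "I \<in> measurable P (count_space UNIV)"
  proof (rule measurableI)
    show "I -` A \<inter> space P \<in> events" for A by (rule subsetD[OF indep_setD_ev1[OF assms(11)] I_sets])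
  qed simp
  have "indep_pair (count_space UNIV) I borel \<epsilon>"
    by (intro indep_pairI indep_setD[OF assms(11)] I_sets \<epsilon>_sets) auto
  then interpret f1: lasso_fold P \<epsilon> \<sigma> X m I b2 \<nu>1 \<delta>
    using assms(5,13,16) by unfold_locales auto
  have vimage_compl: "(\<lambda>\<omega>. - I \<omega>) -` A = I -` {B. - B \<in> A}" for A
    by auto
  have "indep_pair (count_space UNIV) (\<lambda>\<omega>. - I \<omega>) borel \<epsilon>"
  proof (rule indep_pairI)
    show "(\<lambda>\<omega>. - I \<omega>) \<in> measurable P (count_space UNIV)"
      by (rule measurable_compose[OF I_measurable]) simp
    show "prob (((\<lambda>\<omega>. - I \<omega>) -` A \<inter> space P) \<inter> (\<epsilon> -` B \<inter> space P))
        = prob ((\<lambda>\<omega>. - I \<omega>) -` A \<inter> space P) * prob (\<epsilon> -` B \<inter> space P)" if "B \<in> sets borel" for A B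
      unfolding vimage_compl by (rule indep_setD[OF assms(11) I_sets \<epsilon>_sets[OF that]])
  qed simp
  then interpret f2: lasso_fold P \<epsilon> \<sigma> X m "\<lambda>\<omega>. - I \<omega>" b1 \<nu>2 \<delta>
    using assms(5,12,17) by unfold_locales auto
  have half: "prob {\<omega> \<in> space P. i \<in> - I \<omega>} = 1 / 2" for i
  proof -
    have "{\<omega> \<in> space P. i \<in> I \<omega>} \<in> events" by measurable
    from prob_neg[OF this] show ?thesis using assms(10)[of i] by simp
  qed
  have Y: "Y \<omega> = m + \<epsilon> \<omega>" for \<omega> by (simp add: Y_def m_def)
  have t1: "f1.train (I \<omega>) (\<epsilon> \<omega>) = data_on (- I \<omega>) (Y \<omega>)" for \<omega>
    by (simp add: f1.train_def Y)
  have t2: "f2.train (- I \<omega>) (\<epsilon> \<omega>) = data_on (I \<omega>) (Y \<omega>)" for \<omega>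
    by (simp add: f2.train_def Y)
  have N1: "N1 \<omega> = f1.grid_max (I \<omega>) (\<epsilon> \<omega>)" for \<omega> by (simp add: N1_def f1.grid_max_def t1)
  have N2: "N2 \<omega> = f2.grid_max (- I \<omega>) (\<epsilon> \<omega>)" for \<omega> by (simp add: N2_def f2.grid_max_def t2)

  have n: "n > 0" by (simp add: n_def)
  have p: "p \<ge> 1" by (simp add: p_def Suc_leI)
  have M: "(1 / real CARD('n)) * (\<Sum>i\<in>UNIV. (X $ i $ j) ^ 4) \<le> M" for j
    unfolding M_def n_def by (intro Max_ge) auto
  have "0 \<le> (1 / real CARD('n)) * (\<Sum>i\<in>UNIV. (X $ i $ j) ^ 4)" for j by (simp add: sum_nonneg)
  with M have M0: "0 \<le> M" by (meson order_trans)
  \<comment> \<open>In terms of the fourth root of \<open>M\<close>, all powers of \<open>M\<close>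
    in the constants become integer powers.\<close>
  define w where "w = M powr (1 / 4)"
  have w0: "0 \<le> w" by (simp add: w_def)
  have w2: "w\<^sup>2 = M powr (1 / 2)" by (simp add: w_def power2_eq_square powr_add[symmetric])
  have w2': "w\<^sup>2 = sqrt M" using M0 by (simp add: w2 powr_half_sqrt)
  have "w ^ 4 = (w\<^sup>2)\<^sup>2" by (simp add: power_mult[symmetric])
  then have w4: "w ^ 4 = M" using M0 by (simp add: w2')
  have L0: "0 \<le> L" and Ls: "l1_norm \<beta>star \<le> L" using l1_norm_nonneg[of \<beta>star] assms(5) by (auto simp: L_def)

  \<comment> \<open>Rounding up to the grid costs less than one step, which accounts for the summand
    \<open>\<delta>\<close> in \<open>L\<close>.\<close>
  define k where "k = nat \<lceil>l1_norm \<beta>star / \<delta>\<rceil>"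
  have kl: "l1_norm \<beta>star / \<delta> \<le> real k" and ku: "real k < l1_norm \<beta>star / \<delta> + 1"
    using l1_norm_nonneg[of \<beta>star] assms(5) by (auto simp: k_def) linarith+
  have k1: "l1_norm \<beta>star \<le> real k * \<delta>" using kl assms(5) by (simp add: field_simps)
  have k2: "real k * \<delta> \<le> L" using ku assms(5) by (simp add: field_simps L_def)
  have kN: "k \<le> N" if "l1_norm \<beta>star \<le> real N * \<delta>" for N
    using that assms(5) by (simp add: k_def field_simps ceiling_le_iff)

  \<comment> \<open>The pointwise risk bound\<close>
  define q where "q A \<omega> = Max (range (\<lambda>j. \<bar>\<Sum>i\<in>A. \<epsilon> \<omega> $ i * X $ i $ j\<bar>))" for A \<omega>
  define T1 where "T1 \<omega> = L2_set (\<lambda>i. m $ i + \<epsilon> \<omega> $ i) (I \<omega>) * f1.max_aligned (I \<omega>) (\<epsilon> \<omega>)" for \<omega>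
  define T2 where "T2 \<omega> = L2_set (\<lambda>i. m $ i + \<epsilon> \<omega> $ i) (- I \<omega>) * f2.max_aligned (- I \<omega>) (\<epsilon> \<omega>)" for \<omega>
  define D1 where "D1 \<omega> = f1.comparison_noise k (I \<omega>) (\<epsilon> \<omega>)" for \<omega>
  define D2 where "D2 \<omega> = f2.comparison_noise k (- I \<omega>) (\<epsilon> \<omega>)" for \<omega>
  define W1 where "W1 \<omega> = 2 * L * q (- I \<omega>) \<omega> + 4 * L\<^sup>2 * split_imbalance X (I \<omega>) + 4 * T1 \<omega>" for \<omega>
  define W2 where "W2 \<omega> = 2 * L * q (I \<omega>) \<omega> + 4 * L\<^sup>2 * split_imbalance X (I \<omega>) + 4 * T2 \<omega>" for \<omega>
  define W where "W \<omega> = 32 / 7 * (W1 \<omega> + W2 \<omega>) + 16 * L * q UNIV \<omega>" for \<omega>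
  define Z where "Z \<omega> = - (64 / 7) * (D1 \<omega> + D2 \<omega>)" for \<omega>
  have q0: "0 \<le> q A \<omega>" for A \<omega>
    unfolding q_def by (rule order_trans[OF _ Max_ge[OF _ rangeI]]) auto
  have T0: "0 \<le> T1 \<omega>" "0 \<le> T2 \<omega>" for \<omega>
    by (simp_all add: T1_def T2_def f1.max_aligned_nonneg f2.max_aligned_nonneg)
  have W0: "0 \<le> W1 \<omega>" "0 \<le> W2 \<omega>" for \<omega>
    using L0 q0 T0 split_imbalance_nonneg[of X] by (simp_all add: W1_def W2_def)

  define a1 where "a1 \<omega> = (\<Sum>i\<in>I \<omega>. ((X *v \<beta>2 (K1 \<omega>) \<omega>) $ i - m $ i)\<^sup>2)" for \<omega>
  define a2 where "a2 \<omega> = (\<Sum>i\<in>- I \<omega>. ((X *v \<beta>1 (K2 \<omega>) \<omega>) $ i - m $ i)\<^sup>2)" for \<omega>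
  have fold1: "a1 \<omega> \<le> W1 \<omega> - 2 * D1 \<omega>" if \<omega>: "\<omega> \<in> space P" and k: "k \<le> N1 \<omega>" for \<omega>
    using f1.fold_prediction_error[OF m_def, where A = "I \<omega>" and e = "\<epsilon> \<omega>" and K = "K1 \<omega>" and k = k and L = L] assms(22)[OF \<omega>] k k1 k2
    unfolding a1_def W1_def D1_def T1_def q_def \<beta>2_def N1 t1 Y by simp
  have fold2: "a2 \<omega> \<le> W2 \<omega> - 2 * D2 \<omega>" if \<omega>: "\<omega> \<in> space P" and k: "k \<le> N2 \<omega>" for \<omega>
    using f2.fold_prediction_error[OF m_def, where A = "- I \<omega>" and e = "\<epsilon> \<omega>" and K = "K2 \<omega>" and k = k and L = L] assms(23)[OF \<omega>] k k1 k2
    unfolding a2_def W2_def D2_def T2_def q_def \<beta>1_def N2 t2 Y double_compl split_imbalance_Compl by simp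
  \<comment> \<open>If the grid reaches \<open>k\<close>, the expression dominates a sum of squares;
    if not, its centered part is 0 by definition. Nonnegativity thus holds off the event as
    well.\<close>
  have nonneg1: "0 \<le> W1 \<omega> - 2 * D1 \<omega>" if \<omega>: "\<omega> \<in> space P" for \<omega>
  proof (cases "k \<le> N1 \<omega>")
    case True
    have "0 \<le> a1 \<omega>" by (simp add: a1_def sum_nonneg)
    with fold1[OF \<omega> True] show ?thesis by linarith
  next
    case False
    then show ?thesis using W0(1)[of \<omega>] by (simp add: D1_def f1.comparison_noise_def N1)
  qed
  have nonneg2: "0 \<le> W2 \<omega> - 2 * D2 \<omega>" if \<omega>: "\<omega> \<in> space P" for \<omega>
  proof (cases "k \<le> N2 \<omega>")
    case True
    have "0 \<le> a2 \<omega>" by (simp add: a2_def sum_nonneg)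
    with fold2[OF \<omega> True] show ?thesis by linarith
  next
    case False
    then show ?thesis using W0(2)[of \<omega>] by (simp add: D2_def f2.comparison_noise_def N2)
  qed
  have U: "W \<omega> + Z \<omega> = 32 / 7 * ((W1 \<omega> - 2 * D1 \<omega>) + (W2 \<omega> - 2 * D2 \<omega>)) + 16 * L * q UNIV \<omega>" for \<omega>
    by (simp add: W_def Z_def algebra_simps)
  have U0: "0 \<le> W \<omega> + Z \<omega>" if "\<omega> \<in> space P" for \<omega>
    unfolding U using nonneg1[OF that] nonneg2[OF that] L0 q0[of UNIV \<omega>] by simp

  define G where "G = {\<omega>. real (N1 \<omega>) * \<delta> \<ge> l1_norm \<beta>star \<and> real (N2 \<omega>) * \<delta> \<ge> l1_norm \<beta>star}"
  have risk: "(norm (X *v \<beta>CV \<omega> - m))\<^sup>2 \<le> W \<omega> + Z \<omega>" if \<omega>: "\<omega> \<in> space P" and G: "\<omega> \<in> G" for \<omega>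
  proof -
    \<comment> \<open>\<open>Khat\<close> ranges over all radii, not over the grid, so the refit
      competes with the Lasso at exactly the radius \<open>l1_norm \<beta>star\<close>.\<close>
    define g where "g = b (l1_norm \<beta>star) (Y \<omega>)"
    have g_min: "is_arg_min (\<lambda>\<beta>. norm (Y \<omega> - X *v \<beta>)) (\<lambda>\<beta>. l1_norm \<beta> \<le> l1_norm \<beta>star) g"
      using assms(25) l1_norm_nonneg[of \<beta>star] unfolding full_lasso_rule_def g_def by blast
    have lu: "l1_norm (g - \<beta>star) \<le> 2 * L"
      using l1_norm_triangle_diff[of g \<beta>star] g_min Ls by (simp add: is_arg_min_def)
    have "(norm (X *v g - m))\<^sup>2 = (\<Sum>i\<in>UNIV. ((X *v (g - \<beta>star)) $ i)\<^sup>2)"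
      by (simp add: norm_sq_vec m_def matrix_vector_mult_diff_distrib)
    also have "\<dots> \<le> (\<Sum>i\<in>UNIV. (Y \<omega> $ i - (X *v \<beta>star) $ i) * (X *v (g - \<beta>star)) $ i)"
      by (rule lasso_projection[OF arg_min_norm_imp_sq[OF g_min]]) simp
    also have "\<dots> = (\<Sum>i\<in>UNIV. \<epsilon> \<omega> $ i * (X *v (g - \<beta>star)) $ i)" by (simp add: Y m_def)
    also have "\<dots> \<le> l1_norm (g - \<beta>star) * q UNIV \<omega>"
      unfolding q_def using abs_noise_le[where e = "\<lambda>i. \<epsilon> \<omega> $ i" and A = UNIV and X = X and u = "g - \<beta>star"] by linarith
    also have "\<dots> \<le> 2 * L * q UNIV \<omega>" by (intro mult_right_mono lu q0)
    finally have full: "(norm (X *v g - m))\<^sup>2 \<le> 2 * L * q UNIV \<omega>" .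
    have "(norm (\<mu>' \<omega> - m))\<^sup>2 = (\<Sum>i\<in>UNIV. if i \<in> I \<omega> then ((X *v \<beta>2 (K1 \<omega>) \<omega>) $ i - m $ i)\<^sup>2
        else ((X *v \<beta>1 (K2 \<omega>) \<omega>) $ i - m $ i)\<^sup>2)"
      unfolding norm_sq_vec by (intro sum.cong) (auto simp: \<mu>'_def)
    also have "\<dots> = a1 \<omega> + a2 \<omega>" by (simp add: sum.If_cases a1_def a2_def Compl_eq)
    also have "\<dots> \<le> (W1 \<omega> - 2 * D1 \<omega>) + (W2 \<omega> - 2 * D2 \<omega>)"
      using G by (intro add_mono fold1 fold2 \<omega> kN) (auto simp: G_def)
    finally have cv: "(norm (\<mu>' \<omega> - m))\<^sup>2 \<le> (W1 \<omega> - 2 * D1 \<omega>) + (W2 \<omega> - 2 * D2 \<omega>)" .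
    have "norm (\<mu>' \<omega> - X *v \<beta>CV \<omega>) \<le> norm (\<mu>' \<omega> - X *v g)"
      using assms(27)[OF \<omega>] l1_norm_nonneg[of \<beta>star]
      unfolding is_arg_min_def \<beta>CV_def g_def by (meson not_less)
    then have "(norm (X *v \<beta>CV \<omega> - m))\<^sup>2 \<le> 32 / 7 * (norm (\<mu>' \<omega> - m))\<^sup>2 + 8 * (norm (X *v g - m))\<^sup>2"
      by (rule refit_error)
    also have "\<dots> \<le> 32 / 7 * ((W1 \<omega> - 2 * D1 \<omega>) + (W2 \<omega> - 2 * D2 \<omega>)) + 8 * (2 * L * q UNIV \<omega>)"
      by (intro add_mono mult_left_mono full cv) auto
    finally show ?thesis unfolding U by simp
  qed

  \<comment> \<open>Integration of the risk bound\<close>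
  show ?thesis
  proof (cases "l1 = \<top> \<or> l2 = \<top>")
    case True
    \<comment> \<open>Strict positivity matters, since a zero factor times infinity is 0 in
      \<open>ennreal\<close>.\<close>
    have "0 < 4 * \<sigma> ^ 4 + 2 * L\<^sup>2 * M powr (1 / 2) * \<sigma>\<^sup>2"
      using assms(4) by (intro add_pos_nonneg) auto
    then have "C1 / sqrt n > 0" using n by (simp add: C1_def)
    then have "R = \<top>" using True by (auto simp: R_def ennreal_sqrt_def ennreal_mult_top)
    then show ?thesis by simp
  next
    case False
    then obtain r1 r2 where r: "0 \<le> r1" "l1 = ennreal r1" "0 \<le> r2" "l2 = ennreal r2"
      by (metis ennreal_cases)
    define v where "v = n * w\<^sup>2"
    have v: "(\<Sum>i\<in>A. (X $ i $ j)\<^sup>2) \<le> v" for A j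
      using sum_sq_le_moment(1)[OF M, of j A] by (simp add: v_def w2' n_def)
    define qb where "qb = sqrt (2 * (\<sigma>\<^sup>2 * (n * w\<^sup>2)) * ln (2 * p))"
    have lp: "0 \<le> ln (2 * p)" using p by simp
    have "0 \<le> v" using n by (simp add: v_def)
    then have qb0: "0 \<le> qb" using lp by (simp add: qb_def v_def)
    have qm: "mean_le (\<lambda>\<omega>. q (J \<omega>) \<omega>) qb"
      if "(\<lambda>\<omega>. q (J \<omega>) \<omega>) \<in> borel_measurable P"
        and "(\<integral>\<^sup>+\<omega>. ennreal (q (J \<omega>) \<omega>) \<partial>P) \<le> ennreal (sqrt (2 * (\<sigma>\<^sup>2 * v) * ln (2 * real CARD('p))))" for J
      using that q0 qb0 unfolding mean_le_def qb_def v_def p_def by blast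
    have qm0: "mean_le (q UNIV) qb"
    proof (rule qm)
      show "q UNIV \<in> borel_measurable P" unfolding q_def[abs_def] by measurable
    qed (unfold q_def, rule nn_integral_Max_noise_le[OF v])
    have qm1: "mean_le (\<lambda>\<omega>. q (I \<omega>) \<omega>) qb"
    proof (rule qm)
      show "(\<lambda>\<omega>. q (I \<omega>) \<omega>) \<in> borel_measurable P"
        unfolding q_def by (rule f1.split_measurable[of "\<lambda>A e. Max (range (\<lambda>j. \<bar>\<Sum>i\<in>A. e $ i * X $ i $ j\<bar>))"]) measurable
    qed (unfold q_def, rule f1.nn_integral_split_Max_noise_le[OF v])
    have qm2: "mean_le (\<lambda>\<omega>. q (- I \<omega>) \<omega>) qb"
    proof (rule qm)
      show "(\<lambda>\<omega>. q (- I \<omega>) \<omega>) \<in> borel_measurable P"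
        unfolding q_def by (rule f2.split_measurable[of "\<lambda>A e. Max (range (\<lambda>j. \<bar>\<Sum>i\<in>A. e $ i * X $ i $ j\<bar>))"]) measurable
    qed (unfold q_def, rule f2.nn_integral_split_Max_noise_le[OF v])
    define db where "db = sqrt (2 * (n * w ^ 4) * ln (2 * p\<^sup>2))"
    have p2: "1 \<le> p\<^sup>2" using p by (simp add: one_le_power)
    have dm: "mean_le (\<lambda>\<omega>. split_imbalance X (I \<omega>)) db"
    proof -
      have "(\<integral>\<^sup>+\<omega>. ennreal (split_imbalance X (I \<omega>)) \<partial>P) \<le> ennreal db"
        unfolding db_def w4 n_def p_def
        by (rule nn_integral_split_imbalance_le[OF assms(9,10) sum_sq_le_moment(2)[OF M]])
      moreover have "0 \<le> db" using n w0 p2 by (simp add: db_def)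
      moreover have "(\<lambda>\<omega>. split_imbalance X (I \<omega>)) \<in> borel_measurable P"
        by (rule measurable_compose[OF I_measurable]) simp
      ultimately show ?thesis by (simp add: mean_le_def split_imbalance_nonneg)
    qed
    define mm where "mm = (norm m)\<^sup>2"
    have mm: "mm \<le> L\<^sup>2 * (n * w\<^sup>2)"
    proof -
      have "mm \<le> (l1_norm \<beta>star)\<^sup>2 * (n * w\<^sup>2)"
        using prediction_norm_le[OF M, of \<beta>star] by (simp add: mm_def m_def norm_sq_vec n_def w2')
      also have "\<dots> \<le> L\<^sup>2 * (n * w\<^sup>2)"
        using Ls l1_norm_nonneg[of \<beta>star] n by (intro mult_right_mono power_mono) auto
      finally show ?thesis .
    qed
    define tb where "tb r = sqrt ((mm + n * \<sigma>\<^sup>2) / 2 * (3 * \<sigma>\<^sup>2 * r))" for r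
    have tb0: "0 \<le> tb r" if "0 \<le> r" for r using that n by (simp add: tb_def mm_def)
    have tm1: "mean_le T1 (tb r1)"
    proof -
      have "(\<integral>\<^sup>+\<omega>. ennreal (ln (real (f1.grid_max (I \<omega>) (\<epsilon> \<omega>)) + 1)) \<partial>P) = ennreal r1"
        using r(2) by (simp add: l1_def N1)
      then have "(\<integral>\<^sup>+\<omega>. ennreal (T1 \<omega>) \<partial>P) \<le> ennreal (tb r1)"
        unfolding T1_def tb_def mm_def n_def
        by (rule f1.nn_integral_response_aligned_le[OF assms(10) _ r(1)])
      moreover have "T1 \<in> borel_measurable P"
        unfolding T1_def[abs_def]
        by (rule f1.split_measurable[of "\<lambda>A e. L2_set (\<lambda>i. m $ i + e $ i) A * f1.max_aligned A e"])
          (simp add: L2_set_def)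
      ultimately show ?thesis using tb0[OF r(1)] T0 unfolding mean_le_def by blast
    qed
    have tm2: "mean_le T2 (tb r2)"
    proof -
      have "(\<integral>\<^sup>+\<omega>. ennreal (ln (real (f2.grid_max (- I \<omega>) (\<epsilon> \<omega>)) + 1)) \<partial>P) = ennreal r2"
        using r(4) by (simp add: l2_def N2)
      then have "(\<integral>\<^sup>+\<omega>. ennreal (T2 \<omega>) \<partial>P) \<le> ennreal (tb r2)"
        unfolding T2_def tb_def mm_def n_def
        by (rule f2.nn_integral_response_aligned_le[OF half _ r(3)])
      moreover have "T2 \<in> borel_measurable P"
        unfolding T2_def[abs_def]
        by (rule f2.split_measurable[of "\<lambda>A e. L2_set (\<lambda>i. m $ i + e $ i) A * f2.max_aligned A e"])
          (simp add: L2_set_def)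
      ultimately show ?thesis using tb0[OF r(3)] T0 unfolding mean_le_def by blast
    qed
    define B where "B = 32 / 7 * ((2 * L * qb + 4 * L\<^sup>2 * db + 4 * tb r1) + (2 * L * qb + 4 * L\<^sup>2 * db + 4 * tb r2)) + 16 * L * qb"
    have Wm: "mean_le W B"
      unfolding W_def W1_def W2_def B_def
      using L0 by (intro mean_le_add mean_le_mult qm0 qm1 qm2 dm tm1 tm2) auto
    \<comment> \<open>The bound \<open>R\<close> without its summand \<open>E\<close>, as a real
      number.\<close>
    define \<rho> where "\<rho> = C1 / sqrt n * (sqrt r1 + sqrt r2) + C2 * sqrt (ln (2 * p) / n)"
    have "ln (2 * p\<^sup>2) \<le> ln ((2 * p)\<^sup>2)" using p by (simp add: power_mult_distrib)
    also have "\<dots> = 2 * ln (2 * p)" using p ln_realpow[of "2 * p" 2] by simp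
    finally have "B \<le> n * \<rho>"
      using risk_constants[OF L0 w0 assms(4) n lp r(1) r(3) mm, of "ln (2 * p\<^sup>2)"]
      unfolding B_def qb_def db_def tb_def \<rho>_def C1_def C2_def w2[symmetric] w_def[symmetric] by blast
    have C0: "0 \<le> C1" "0 \<le> C2" using L0 assms(4) by (auto simp: C1_def C2_def)
    have \<rho>0: "0 \<le> \<rho>" using C0 n r lp by (simp add: \<rho>_def)
    have Zc: "integrable P Z" "expectation Z = 0"
      using f1.comparison_noise_centered[of k] f2.comparison_noise_centered[of k]
      unfolding Z_def D1_def D2_def by auto
    have Wmeas [measurable]: "W \<in> borel_measurable P" and Wnn: "0 \<le> W \<omega>" for \<omega>
      using Wm by (auto simp: mean_le_def)
    have Zmeas [measurable]: "Z \<in> borel_measurable P" using Zc by auto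
    have "(\<integral>\<^sup>+\<omega>. ennreal (W \<omega> + Z \<omega>) \<partial>P) \<le> (\<integral>\<^sup>+\<omega>. ennreal (W \<omega>) \<partial>P)"
      by (rule nn_integral_add_centered_le[OF Wmeas Wnn U0 Zc])
    also have "\<dots> \<le> ennreal B" using Wm by (simp add: mean_le_def)
    also have "\<dots> \<le> ennreal (n * \<rho>)" using \<open>B \<le> n * \<rho>\<close> by (rule ennreal_leI)
    finally have EU: "(\<integral>\<^sup>+\<omega>. ennreal (W \<omega> + Z \<omega>) \<partial>P) \<le> ennreal (real CARD('n) * \<rho>)" by (simp add: n_def)
    have "\<sigma>hat2 \<omega> = (norm (\<epsilon> \<omega> - (X *v \<beta>CV \<omega> - m)))\<^sup>2 / real CARD('n)" for \<omega>
      by (simp add: \<sigma>hat2_def Y n_def algebra_simps)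
    then have "(\<integral>\<^sup>+\<omega>. ennreal \<bar>\<sigma>hat2 \<omega> - \<sigma>\<^sup>2\<bar> * indicator G \<omega> \<partial>P)
        \<le> ennreal (\<sigma>\<^sup>2 * sqrt (2 / n)) + ennreal (2 * \<sigma> * sqrt \<rho>) + ennreal \<rho>"
      using nn_integral_variance_estimate_le[OF _ U0 EU \<rho>0, of G "\<lambda>\<omega>. X *v \<beta>CV \<omega> - m"] risk
      by (simp add: n_def)
    also have "\<dots> \<le> ennreal (\<sigma>\<^sup>2 * sqrt (2 / n)) + ennreal (2 * \<sigma>) * ennreal_sqrt R + R"
    proof (intro add_mono order_refl)
      have "ennreal \<rho> = ennreal (C1 / sqrt n * (sqrt r1 + sqrt r2)) + ennreal (C2 * sqrt (ln (2 * p) / n))"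
        unfolding \<rho>_def using C0 n r lp by (intro ennreal_plus) auto
      also have "ennreal (C1 / sqrt n * (sqrt r1 + sqrt r2)) = ennreal (C1 / sqrt n) * ennreal (sqrt r1 + sqrt r2)"
        using C0 n r by (intro ennreal_mult) auto
      also have "ennreal (sqrt r1 + sqrt r2) = ennreal_sqrt l1 + ennreal_sqrt l2"
        using r by simp
      finally show le: "ennreal \<rho> \<le> R" unfolding R_def by simp
      have "ennreal (2 * \<sigma> * sqrt \<rho>) = ennreal (2 * \<sigma>) * ennreal_sqrt (ennreal \<rho>)"
        using assms(4) \<rho>0 by (simp add: ennreal_mult)
      also have "\<dots> \<le> ennreal (2 * \<sigma>) * ennreal_sqrt R"
        by (intro mult_left_mono ennreal_sqrt_mono le) simp
      finally show "ennreal (2 * \<sigma> * sqrt \<rho>) \<le> ennreal (2 * \<sigma>) * ennreal_sqrt R" .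
    qed
    finally show ?thesis unfolding G_def .
  qed
qed

end
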